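(* Let $V=V^{DQ}$, let $1\le r\le d$, and let $X^r=\mathrm{span}\{\varphi_1,\dots,\varphi_r\}$ be the corresponding POD space. Let $u$ be the solution of the weak heat equation, $u_r$ the solution of the POD Galerkin reduced order model, $R_r$ the Ritz projection onto $X^r$, $\eta^{Ritz}:=u-R_r(u)$ and $\phi_r:=u_r-R_r(u)$. Then for all $t\in[0,T]$ $$\frac{d}{dt}\|\nabla\phi_r\|^2\le\frac1\nu\,\|\eta^{Ritz}_t\|^2 .$$
   Context: Let $\Omega\subset\mathbb{R}^n$ be a bounded domain, $X:=H_0^1(\Omega)$, $T>0$, $\nu>0$; $(\cdot,\cdot)$ and $\|\cdot\|$ are the $L^2(\Omega)$ inner product and norm. A subscript $t$ denotes the time derivative. The function $u(\cdot,t)\in X$, $t\in[0,T]$, is the weak solution of the heat equation: $(u_t,v)+\nu(\nabla u,\nabla v)=(f,v)$ for all $v\in X$. It is assumed that $u\in C^1([0,T];X)$ and $f\in C([0,T];L^2(\Omega))$. Snapshots and POD: given equally spaced times $t_0,\dots,t_N\in[0,T]$ with step $\Delta t$, set $\overline{\partial}u(t_n):=(u(t_n)-u(t_{n-1}))/\Delta t$ for $n=1,\dots,N$ (difference quotients), and $V^{DQ}:=\mathrm{span}\{u(\cdot,t_0),\dots,u(\cdot,t_N),\overline{\partial}u(\cdot,t_1),\dots,\overline{\partial}u(\cdot,t_N)\}$. Write $s_1,\dots,s_M$ ($M=2N+1$) for these spanning functions and $d=\dim V^{DQ}$. Let $K\in\mathbb{R}^{M\times M}$, $K_{ij}=\frac1M(s_j,s_i)$,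 with positive eigenvalues $\lambda_1\ge\dots\ge\lambda_d>0$ and associated orthonormal eigenvectors $v_1,\dots,v_d$. The POD basis functions are $\varphi_k=\lambda_k^{-1/2}\sum_{j=1}^M (v_k)_j s_j$, $1\le k\le r$; they are $L^2$-orthonormal and lie in $X$. Reduced order model: $u_r(\cdot,t)\in X^r$ (continuously differentiable in $t$) satisfies $(u_{r,t},v_r)+\nu(\nabla u_r,\nabla v_r)=(f,v_r)$ for all $v_r\in X^r$ and $t\in[0,T]$, with some initial value $u_r(0)\in X^r$. Ritz projection: for $w\in X$, $R_r(w)\in X^r$ is defined by $(\nabla(w-R_r(w)),\nabla v_r)=0$ for all $v_r\in X^r$; it is applied at each time $t$. *)

theory Defs
  imports "HOL-Analysis.Analysis" "Jordan_Normal_Form.Char_Poly"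
begin

no_notation scalar_prod (infix \<open>\<bullet>\<close> 70)


section \<open>The Hilbert space of square-integrable functions modulo null sets\<close>

definition square_integrable :: "('a::euclidean_space \<Rightarrow> real) \<Rightarrow> bool" where
  "square_integrable f \<longleftrightarrow>
     f \<in> borel_measurable lebesgue \<and> integrable lebesgue (\<lambda>x. (f x)\<^sup>2)"

definition L2_rel :: "('a::euclidean_space \<Rightarrow> real) \<Rightarrow> ('a \<Rightarrow> real) \<Rightarrow> bool" where
  "L2_rel f g \<longleftrightarrow>
     square_integrable f \<and> square_integrable g \<and> (AE x in lebesgue. f x = g x)"

lemma square_integrable_zero: "square_integrable (\<lambda>_. 0)"
  by (simp add: square_integrable_def)

lemma L2_rel_part_equivp: "part_equivp (L2_rel :: ('a::euclidean_space \<Rightarrow> real) \<Rightarrow> _)"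
  (is "part_equivp ?R")
proof (rule part_equivpI)
  show "\<exists>f. ?R f f"
    using square_integrable_zero by (auto simp: L2_rel_def)
  show "symp ?R"
    unfolding symp_def L2_rel_def by (metis (mono_tags, lifting) eventually_mono)
  show "transp ?R"
  proof (rule transpI)
    fix f g h :: "'a \<Rightarrow> real"
    assume fg: "L2_rel f g" and gh: "L2_rel g h"
    have "AE x in lebesgue. f x = g x" "AE x in lebesgue. g x = h x"
      using fg gh by (auto simp: L2_rel_def)
    then have "AE x in lebesgue. f x = h x"
      by eventually_elim simp
    then show "L2_rel f h"
      using fg gh by (simp add: L2_rel_def)
  qed
qed

quotient_type (overloaded) 'a L2 = "'a::euclidean_space \<Rightarrow> real" / partial: L2_rel
  by (rule L2_rel_part_equivp)

lemma square_integrable_mult: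
  assumes "square_integrable f" "square_integrable g"
  shows "integrable lebesgue (\<lambda>x. f x * g x)"
proof (rule Bochner_Integration.integrable_bound)
  show "integrable lebesgue (\<lambda>x. (f x)\<^sup>2 + (g x)\<^sup>2)"
    using assms by (simp add: square_integrable_def)
  show "(\<lambda>x. f x * g x) \<in> borel_measurable lebesgue"
    using assms by (auto simp: square_integrable_def)
  have "\<bar>a * b\<bar> \<le> \<bar>a\<^sup>2 + b\<^sup>2\<bar>" for a b :: real
  proof -
    have "0 \<le> (\<bar>a\<bar> - \<bar>b\<bar>)\<^sup>2" by simp
    then have "2 * (\<bar>a\<bar> * \<bar>b\<bar>) \<le> a\<^sup>2 + b\<^sup>2" by (simp add: power2_diff)
    moreover have "0 \<le> \<bar>a\<bar> * \<bar>b\<bar>" by simp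
    ultimately show ?thesis unfolding abs_mult by linarith
  qed
  then show "AE x in lebesgue. norm (f x * g x) \<le> norm ((f x)\<^sup>2 + (g x)\<^sup>2)"
    by simp
qed

lemma square_integrable_scale:
  assumes "square_integrable f"
  shows "square_integrable (\<lambda>x. c * f x)"
  using assms by (auto simp: square_integrable_def power_mult_distrib)

lemma square_integrable_add:
  assumes "square_integrable f" "square_integrable g"
  shows "square_integrable (\<lambda>x. f x + g x)"
proof -
  have "integrable lebesgue (\<lambda>x. (f x)\<^sup>2 + (g x)\<^sup>2 + 2 * (f x * g x))"
    using assms square_integrable_mult[OF assms] by (simp add: square_integrable_def)
  then show ?thesis
    using assms by (auto simp: square_integrable_def power2_sum mult.assoc)
qed

instantiation L2 :: (euclidean_space) real_vector
begin

lift_definition zero_L2 :: "'a L2" is "\<lambda>_. 0"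
  by (simp add: L2_rel_def square_integrable_zero)

lift_definition plus_L2 :: "'a L2 \<Rightarrow> 'a L2 \<Rightarrow> 'a L2" is "\<lambda>f g x. f x + g x"
  by (auto simp: L2_rel_def square_integrable_add elim: eventually_elim2)

lift_definition scaleR_L2 :: "real \<Rightarrow> 'a L2 \<Rightarrow> 'a L2" is "\<lambda>c f x. c * f x"
  by (auto simp: L2_rel_def square_integrable_scale)

definition uminus_L2 :: "'a L2 \<Rightarrow> 'a L2" where "- w = (-1) *\<^sub>R (w :: 'a L2)"

definition minus_L2 :: "'a L2 \<Rightarrow> 'a L2 \<Rightarrow> 'a L2" where "v - w = v + (-1) *\<^sub>R (w :: 'a L2)"

instance
proof
  fix u v w :: "'a L2" and a b :: real
  show "u + v + w = u + (v + w)"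
    by transfer (auto simp: L2_rel_def add.assoc intro!: square_integrable_add)
  show "u + v = v + u"
    by transfer (auto simp: L2_rel_def add.commute intro!: square_integrable_add)
  show "0 + u = u"
    by transfer (auto simp: L2_rel_def)
  show "- u + u = 0"
    unfolding uminus_L2_def
    by transfer (auto simp: L2_rel_def square_integrable_zero)
  show "u - v = u + - v"
    by (simp add: uminus_L2_def minus_L2_def)
  show "a *\<^sub>R (u + v) = a *\<^sub>R u + a *\<^sub>R v"
    by transfer (auto simp: L2_rel_def distrib_left
        intro!: square_integrable_add square_integrable_scale)
  show "(a + b) *\<^sub>R u = a *\<^sub>R u + b *\<^sub>R u"
    by transfer (auto simp: L2_rel_def distrib_right square_integrable_scale
        intro!: square_integrable_add square_integrable_scale
          square_integrable_scale[of _ "a + b", unfolded distrib_right])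
  show "a *\<^sub>R b *\<^sub>R u = (a * b) *\<^sub>R u"
    by transfer (auto simp: L2_rel_def mult.assoc
        intro!: square_integrable_scale square_integrable_scale[of _ "a * b", unfolded mult.assoc])
  show "1 *\<^sub>R u = u"
    by transfer (auto simp: L2_rel_def)
qed

end

instantiation L2 :: (euclidean_space) real_inner
begin

lift_definition inner_L2 :: "'a L2 \<Rightarrow> 'a L2 \<Rightarrow> real" is "\<lambda>f g. \<integral>x. f x * g x \<partial>lebesgue"
proof -
  fix f f' g g' :: "'a \<Rightarrow> real"
  assume f: "L2_rel f f'" and g: "L2_rel g g'"
  have "AE x in lebesgue. f x = f' x" "AE x in lebesgue. g x = g' x"
    using f g by (auto simp: L2_rel_def)
  then have "AE x in lebesgue. f x * g x = f' x * g' x"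
    by eventually_elim simp
  moreover have "(\<lambda>x. f x * g x) \<in> borel_measurable lebesgue"
    "(\<lambda>x. f' x * g' x) \<in> borel_measurable lebesgue"
    using f g by (auto simp: L2_rel_def square_integrable_def)
  ultimately show "(\<integral>x. f x * g x \<partial>lebesgue) = (\<integral>x. f' x * g' x \<partial>lebesgue)"
    by (intro integral_cong_AE)
qed

definition norm_L2 :: "'a L2 \<Rightarrow> real" where "norm w = sqrt (inner w (w :: 'a L2))"

definition sgn_L2 :: "'a L2 \<Rightarrow> 'a L2" where "sgn w = w /\<^sub>R norm (w :: 'a L2)"

definition dist_L2 :: "'a L2 \<Rightarrow> 'a L2 \<Rightarrow> real" where "dist v w = norm (v - w :: 'a L2)"

definition uniformity_L2 :: "('a L2 \<times> 'a L2) filter" where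
  "uniformity = (INF e\<in>{0 <..}. principal {(v, w). dist (v :: 'a L2) w < e})"

definition open_L2 :: "'a L2 set \<Rightarrow> bool" where
  "open (U :: 'a L2 set) \<longleftrightarrow> (\<forall>v\<in>U. eventually (\<lambda>(v', w). v' = v \<longrightarrow> w \<in> U) uniformity)"

instance
proof
  fix u v w :: "'a L2" and a :: real and U :: "'a L2 set"
  show "dist v w = norm (v - w)" by (rule dist_L2_def)
  show "sgn w = w /\<^sub>R norm w" by (rule sgn_L2_def)
  show "uniformity = (INF e\<in>{0 <..}. principal {(v, w). dist (v :: 'a L2) w < e})"
    by (rule uniformity_L2_def)
  show "open U \<longleftrightarrow> (\<forall>v\<in>U. eventually (\<lambda>(v', w). v' = v \<longrightarrow> w \<in> U) uniformity)"
    by (rule open_L2_def)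
  show "inner v w = inner w v"
    by transfer (simp add: mult.commute)
  show "inner (u + v) w = inner u w + inner v w"
    by transfer (simp add: L2_rel_def distrib_right square_integrable_mult)
  show "inner (a *\<^sub>R v) w = a * inner v w"
    by transfer (simp add: L2_rel_def mult.assoc square_integrable_mult)
  show "0 \<le> inner w w"
    by transfer simp
  show "inner w w = 0 \<longleftrightarrow> w = 0"
  proof transfer
    fix f :: "'a \<Rightarrow> real"
    assume "L2_rel f f"
    then have f: "square_integrable f" by (simp add: L2_rel_def)
    have "(\<integral>x. f x * f x \<partial>lebesgue) = 0 \<longleftrightarrow> (AE x in lebesgue. f x * f x = 0)"
      by (rule integral_nonneg_eq_0_iff_AE) (simp_all add: square_integrable_mult f)
    then show "(\<integral>x. f x * f x \<partial>lebesgue) = 0 \<longleftrightarrow> L2_rel f (\<lambda>_. 0)"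
      by (simp add: L2_rel_def f square_integrable_zero)
  qed
  show "norm w = sqrt (inner w w)" by (rule norm_L2_def)
qed

end

text \<open>
  L2(Omega) is identified, by extension by zero, with the subspace of those elements of
  L2 over the whole space that vanish almost everywhere outside Omega; inner product and norm
  are then the integrals over Omega.
\<close>

definition L2_on :: "'a::euclidean_space set \<Rightarrow> 'a L2 set" where
  "L2_on \<Omega> = {w. AE x in lebesgue. x \<notin> \<Omega> \<longrightarrow> rep_L2 w x = 0}"


section \<open>Sobolev spaces\<close>

definition partial_deriv :: "'n::finite \<Rightarrow> (real^'n \<Rightarrow> real) \<Rightarrow> real^'n \<Rightarrow> real" where
  "partial_deriv i \<psi> x = frechet_derivative \<psi> (at x) (axis i 1)"

text \<open>
  A function is smooth iff all its iterated partial derivatives, of every order, are everywhere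
  differentiable; the list gives the directions of differentiation.
\<close>

definition smooth :: "(real^'n::finite \<Rightarrow> real) \<Rightarrow> bool" where
  "smooth \<psi> \<longleftrightarrow> (\<forall>is. foldr partial_deriv is \<psi> differentiable_on UNIV)"

definition test_functions :: "(real^'n::finite) set \<Rightarrow> (real^'n \<Rightarrow> real) set" where
  "test_functions \<Omega> =
     {\<psi>. smooth \<psi> \<and> compact (closure {x. \<psi> x \<noteq> 0}) \<and> closure {x. \<psi> x \<noteq> 0} \<subseteq> \<Omega>}"

definition weak_gradient :: "(real^'n::finite) set \<Rightarrow> (real^'n) L2 \<Rightarrow> (real^'n) L2 ^ 'n \<Rightarrow> bool" where
  "weak_gradient \<Omega> w g \<longleftrightarrow>
     (\<forall>i. vec_nth g i \<in> L2_on \<Omega> \<and>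
        (\<forall>\<psi>\<in>test_functions \<Omega>.
           (\<integral>x. rep_L2 w x * partial_deriv i \<psi> x \<partial>lebesgue_on \<Omega>) =
           - (\<integral>x. rep_L2 (vec_nth g i) x * \<psi> x \<partial>lebesgue_on \<Omega>)))"

definition H1 :: "(real^'n::finite) set \<Rightarrow> (real^'n) L2 set" where
  "H1 \<Omega> = {w \<in> L2_on \<Omega>. \<exists>g. weak_gradient \<Omega> w g}"

definition grad :: "(real^'n::finite) set \<Rightarrow> (real^'n) L2 \<Rightarrow> (real^'n) L2 ^ 'n" where
  "grad \<Omega> w = (THE g. weak_gradient \<Omega> w g)"

text \<open>
  The norm of the pair of a function and its gradient is the H1 norm, so topological notions
  of H1(Omega) are expressed through this embedding.
\<close>

definition H1_embed ::
  "(real^'n::finite) set \<Rightarrow> (real^'n) L2 \<Rightarrow> (real^'n) L2 \<times> ((real^'n) L2 ^ 'n)" where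
  "H1_embed \<Omega> w = (w, grad \<Omega> w)"

definition H10 :: "(real^'n::finite) set \<Rightarrow> (real^'n) L2 set" where
  "H10 \<Omega> = {w \<in> H1 \<Omega>. H1_embed \<Omega> w \<in> closure (H1_embed \<Omega> ` abs_L2 ` test_functions \<Omega>)}"

text \<open>
  Membership in C1([0,T];Y) for a subspace Y of H1(Omega) carrying the H1 norm.
\<close>

definition C1_into ::
  "(real^'n::finite) set \<Rightarrow> (real^'n) L2 set \<Rightarrow> real \<Rightarrow> (real \<Rightarrow> (real^'n) L2) \<Rightarrow> bool" where
  "C1_into \<Omega> Y T w \<longleftrightarrow>
     (\<forall>t\<in>{0..T}. w t \<in> Y) \<and>
     (\<exists>w'. (\<forall>t\<in>{0..T}. w' t \<in> Y \<and>
              ((\<lambda>s. H1_embed \<Omega> (w s)) has_vector_derivative H1_embed \<Omega> (w' t)) (at t within {0..T})) \<and>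
           continuous_on {0..T} (\<lambda>t. H1_embed \<Omega> (w' t)))"

abbreviation time_deriv :: "real \<Rightarrow> (real \<Rightarrow> 'b::real_normed_vector) \<Rightarrow> real \<Rightarrow> 'b" where
  "time_deriv T w t \<equiv> vector_derivative w (at t within {0..T})"


section \<open>The heat equation and its POD reduced order model\<close>

text \<open>V = H10(Omega) gives the weak heat equation, V = X^r the reduced order model.\<close>

definition galerkin_heat ::
  "(real^'n::finite) set \<Rightarrow> (real^'n) L2 set \<Rightarrow> real \<Rightarrow> real \<Rightarrow>
     (real \<Rightarrow> (real^'n) L2) \<Rightarrow> (real \<Rightarrow> (real^'n) L2) \<Rightarrow> bool" where
  "galerkin_heat \<Omega> V T \<nu> f w \<longleftrightarrow>
     (\<forall>t\<in>{0..T}. w t \<in> V \<and>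
        (\<forall>v\<in>V. inner (time_deriv T w t) v + \<nu> * inner (grad \<Omega> (w t)) (grad \<Omega> v) = inner (f t) v))"

text \<open>
  Snapshots, indexed from 0: entries 0 to N are the values of w at the times \<tau>, entries
  N + 1 to 2 N are its difference quotients.
\<close>

definition snapshot :: "nat \<Rightarrow> real \<Rightarrow> (nat \<Rightarrow> real) \<Rightarrow> (real \<Rightarrow> 'b::real_vector) \<Rightarrow> nat \<Rightarrow> 'b" where
  "snapshot N \<Delta>t \<tau> w j =
     (if j \<le> N then w (\<tau> j) else (w (\<tau> (j - N)) - w (\<tau> (j - N - 1))) /\<^sub>R \<Delta>t)"

definition correlation_matrix :: "nat \<Rightarrow> (nat \<Rightarrow> 'b::real_inner) \<Rightarrow> real mat" where
  "correlation_matrix M s = Matrix.mat M M (\<lambda>(i, j). 1 / real M * inner (s j) (s i))"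

definition pod_basis ::
  "nat \<Rightarrow> (nat \<Rightarrow> 'b::real_vector) \<Rightarrow> (nat \<Rightarrow> real) \<Rightarrow> (nat \<Rightarrow> real Matrix.vec) \<Rightarrow> nat \<Rightarrow> 'b" where
  "pod_basis M s lam ev k = (lam k) powr (-1/2) *\<^sub>R (\<Sum>j<M. vec_index (ev k) j *\<^sub>R s j)"

definition ritz_projection ::
  "(real^'n::finite) set \<Rightarrow> (real^'n) L2 set \<Rightarrow> (real^'n) L2 \<Rightarrow> (real^'n) L2" where
  "ritz_projection \<Omega> V w =
     (THE p. p \<in> V \<and> (\<forall>v\<in>V. inner (grad \<Omega> (w - p)) (grad \<Omega> v) = 0))"

end

(*
  For v in the POD space X^r, subtracting the two Galerkin equations and using that the Ritz
  projection is gradient-orthogonal gives (phi_t, v) + nu (grad phi, grad v) = (eta_t, v), where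
  phi = u_r - R u and eta = u - R u. The choice v = phi_t yields
  nu/2 d/dt |grad phi|^2 = (eta_t, phi_t) - |phi_t|^2 <= |eta_t|^2 / 4.
  The choice is admissible because the Ritz projection factors as w |-> L (grad w) with L bounded
  linear into X^r: the Poincare inequality on H10 turns the contraction grad o L into a bound on L.
  Hence R u is differentiable in time. The POD structure enters only through X^r being a
  finite-dimensional subspace of H10.
*)

theory Submission
  imports Defs
begin

section \<open>Test functions from the flat exponential\<close>

text \<open>\<open>grad\<close> and \<open>ritz_projection\<close> are definite descriptions, so
  neither can be used before existence and uniqueness are known; most of the development serves
  this. Uniqueness of weak gradients is the fundamental lemma of the calculus of variations, which
  needs enough test functions. Since \<open>smooth\<close> asks for partial derivatives along every
  list of directions, the bumps are products of one-variable functions taken from a class closed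
  under differentiation. Uniqueness of the Ritz projection is injectivity of the gradient on
  \<open>X\<^sub>r\<close>, a second use of the Poincare inequality. That inequality is proved for
  test functions by integrating the derivative of x_i psi^2 and is carried to \<open>H10\<close> by
  density, with constant 2 R when Omega lies in the ball of radius R. The gradient need not be
  continuous in the L2 norm, so differentiating R u in L2 would say nothing about grad (R u). Two
  facts close this gap: u is differentiable in the H1 norm, and grad o L is itself a bounded
  operator.\<close>

definition flat_exp :: "nat \<Rightarrow> real \<Rightarrow> real" where
  "flat_exp m t = (if 0 < t then exp (- inverse t) * inverse t ^ m else 0)"

lemma flat_exp_tendsto_zero: "(flat_exp m \<longlongrightarrow> 0) (at 0)"
proof -
  have "((\<lambda>t::real. inverse t ^ m / exp (inverse t)) \<longlongrightarrow> 0) (at_right 0)"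
    using filterlim_compose[OF tendsto_power_div_exp_0 filterlim_inverse_at_top_right] .
  then have R: "(flat_exp m \<longlongrightarrow> 0) (at_right 0)"
    by (rule Lim_transform_eventually)
      (auto simp: eventually_at_right_field flat_exp_def exp_minus field_simps intro!: exI[of _ 1])
  have L: "(flat_exp m \<longlongrightarrow> 0) (at_left 0)"
    by (rule Lim_transform_eventually[OF tendsto_const])
      (auto simp: eventually_at_left_field flat_exp_def intro!: exI[of _ "-1"])
  show ?thesis using L R by (simp add: filterlim_at_split)
qed

text \<open>The powers of \<open>inverse t\<close> are built into the family so that differentiation
  only shifts the index: the exponential contributes two more powers, the power factor one
  more.\<close>

lemma flat_exp_deriv:
  "(flat_exp m has_real_derivative flat_exp (m + 2) t - m * flat_exp (m + 1) t) (at t)"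
proof -
  consider "t < 0" | "t = 0" | "0 < t" by linarith
  then show ?thesis
  proof cases
    case 1
    have "((\<lambda>_. 0) has_real_derivative 0) (at t)" by simp
    then have "(flat_exp m has_real_derivative 0) (at t)"
      by (rule has_field_derivative_transform_within[where d = "-t"])
        (use 1 in \<open>auto simp: flat_exp_def dist_real_def\<close>)
    with 1 show ?thesis by (simp add: flat_exp_def)
  next
    case 2
    \<comment> \<open>Division by h raises the exponent by one, so the difference quotient of
      \<open>flat_exp m\<close> at 0 is \<open>flat_exp (Suc m)\<close>, whose limit is already
      known.\<close>
    have "((\<lambda>h. (flat_exp m (0 + h) - flat_exp m 0) / h) \<longlongrightarrow> 0) (at 0)"
      by (rule Lim_transform_eventually[OF flat_exp_tendsto_zero[of "Suc m"]])
        (auto simp: flat_exp_def eventually_at field_simps intro!: exI[of _ 1])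
    with 2 show ?thesis by (simp add: DERIV_def) (simp add: flat_exp_def)
  next
    case 3
    \<comment> \<open>The power rule produces the truncated exponent \<open>m - Suc 0\<close>; for m
      = 0 the factor \<open>real m\<close> makes this harmless.\<close>
    have *: "real m * inverse t ^ (m - Suc 0) * inverse t ^ 2 = m * inverse t ^ (m + 1)"
      by (cases m) (auto simp: power2_eq_square)
    have "((\<lambda>t. exp (- inverse t) * inverse t ^ m) has_real_derivative
        exp (- inverse t) * inverse t ^ (m + 2) - exp (- inverse t) * (real m * inverse t ^ (m - Suc 0) * inverse t ^ 2)) (at t)"
      using 3 by (auto intro!: derivative_eq_intros simp: power2_eq_square algebra_simps)
    then have "((\<lambda>t. exp (- inverse t) * inverse t ^ m) has_real_derivative
        exp (- inverse t) * inverse t ^ (m + 2) - m * (exp (- inverse t) * inverse t ^ (m + 1))) (at t)"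
      unfolding * by (simp add: algebra_simps)
    then have "(flat_exp m has_real_derivative
        exp (- inverse t) * inverse t ^ (m + 2) - m * (exp (- inverse t) * inverse t ^ (m + 1))) (at t)"
      by (rule has_field_derivative_transform_within[where d = t])
        (use 3 in \<open>auto simp: flat_exp_def dist_real_def\<close>)
    with 3 show ?thesis by (simp add: flat_exp_def)
  qed
qed

text \<open>A class of one-variable functions that is visibly closed under differentiation.\<close>

inductive flat_fun :: "(real \<Rightarrow> real) \<Rightarrow> bool" where
  const: "flat_fun (\<lambda>_. c)"
| flat: "flat_fun (\<lambda>t. flat_exp m (a * t + b))"
| add: "flat_fun f \<Longrightarrow> flat_fun g \<Longrightarrow> flat_fun (\<lambda>t. f t + g t)"
| mult: "flat_fun f \<Longrightarrow> flat_fun g \<Longrightarrow> flat_fun (\<lambda>t. f t * g t)"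

lemma flat_fun_deriv:
  "flat_fun f \<Longrightarrow> \<exists>f'. flat_fun f' \<and> (\<forall>t. (f has_real_derivative f' t) (at t))"
proof (induction rule: flat_fun.induct)
  case (const c)
  show ?case by (intro exI[of _ "\<lambda>_. 0"]) (auto intro: flat_fun.const)
next
  case (flat m a b)
  let ?f' = "\<lambda>t. a * (flat_exp (m + 2) (a * t + b) + (- real m) * flat_exp (m + 1) (a * t + b))"
  have "((\<lambda>t. flat_exp m (a * t + b)) has_real_derivative ?f' t) (at t)" for t
    by (rule DERIV_cong[OF DERIV_chain2[OF flat_exp_deriv]])
      (auto intro!: derivative_eq_intros simp: algebra_simps)
  moreover have "flat_fun ?f'" by (intro flat_fun.intros)
  ultimately show ?case by (intro exI[of _ ?f']) simp
next
  case (add f g)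
  then obtain f' g' where "flat_fun f'" "\<forall>t. (f has_real_derivative f' t) (at t)"
    "flat_fun g'" "\<forall>t. (g has_real_derivative g' t) (at t)" by blast
  then show ?case
    by (intro exI[of _ "\<lambda>t. f' t + g' t"]) (auto intro!: flat_fun.add derivative_eq_intros)
next
  case (mult f g)
  then obtain f' g' where "flat_fun f'" "\<forall>t. (f has_real_derivative f' t) (at t)"
    "flat_fun g'" "\<forall>t. (g has_real_derivative g' t) (at t)" by blast
  with mult show ?case
    by (intro exI[of _ "\<lambda>t. f' t * g t + g' t * f t"])
      (auto intro!: flat_fun.add flat_fun.mult DERIV_mult)
qed

lemma partial_deriv_eqI:
  "(\<psi> has_derivative D) (at x) \<Longrightarrow> partial_deriv i \<psi> x = D (axis i 1)"
  unfolding partial_deriv_def by (simp add: frechet_derivative_at[symmetric])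

text \<open>Differentiating in direction k replaces the k-th factor by its derivative and leaves the
  others alone, so products of \<open>flat_fun\<close> factors are mapped to such products.
  Induction over the list of directions proves this invariance, which is stronger than
  differentiability; the latter is then read off once at the end.\<close>

lemma smooth_flat_product:
  fixes G :: "'n::finite \<Rightarrow> real \<Rightarrow> real"
  assumes "\<forall>i. flat_fun (G i)"
  shows "smooth (\<lambda>x::real^'n. \<Prod>i\<in>UNIV. G i (vec_nth x i))"
proof -
  have diff: "((\<lambda>x::real^'n. \<Prod>i\<in>UNIV. G i (vec_nth x i)) has_derivative
      (\<lambda>y. \<Sum>i\<in>UNIV. (vec_nth y i * G' i (vec_nth x i)) * (\<Prod>j\<in>UNIV - {i}. G j (vec_nth x j)))) (at x)"
    if "\<And>i t. (G i has_real_derivative G' i t) (at t)" for G G' :: "'n \<Rightarrow> real \<Rightarrow> real" and x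
  proof (rule has_derivative_prod)
    fix i
    have "((\<lambda>x. G i (vec_nth x i)) has_derivative (\<lambda>y. (vec_nth y i) * G' i (vec_nth x i))) (at x)"
      using has_derivative_compose[OF bounded_linear_imp_has_derivative[OF bounded_linear_vec_nth]
          that[of i "vec_nth x i", unfolded has_field_derivative_def]]
      by (simp add: mult.commute)
    then show "((\<lambda>x. G i (vec_nth x i)) has_derivative (\<lambda>y. vec_nth y i * G' i (vec_nth x i))) (at x within UNIV)"
      by simp
  qed
  have "\<exists>G. (\<forall>i. flat_fun (G i)) \<and>
      foldr partial_deriv is (\<lambda>x::real^'n. \<Prod>i\<in>UNIV. G0 i (vec_nth x i)) = (\<lambda>x. \<Prod>i\<in>UNIV. G i (vec_nth x i))"
    if "\<forall>i. flat_fun (G0 i)" for "is" and G0 :: "'n \<Rightarrow> real \<Rightarrow> real"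
    using that
  proof (induction "is")
    case Nil
    then show ?case by auto
  next
    case (Cons k "is")
    then obtain G where G: "\<forall>i. flat_fun (G i)"
      and eq: "foldr partial_deriv is (\<lambda>x::real^'n. \<Prod>i\<in>UNIV. G0 i (vec_nth x i)) = (\<lambda>x. \<Prod>i\<in>UNIV. G i (vec_nth x i))"
      by blast
    have "\<forall>i. \<exists>f'. flat_fun f' \<and> (\<forall>t. (G i has_real_derivative f' t) (at t))"
      using G flat_fun_deriv by blast
    from choice[OF this] obtain G' where G': "\<And>i. flat_fun (G' i)"
      "\<And>i t. (G i has_real_derivative G' i t) (at t)" by blast
    have "partial_deriv k (\<lambda>x::real^'n. \<Prod>i\<in>UNIV. G i (vec_nth x i)) x
        = (\<Prod>i\<in>UNIV. (G(k := G' k)) i (vec_nth x i))" for x :: "real^'n"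
    proof -
      have "partial_deriv k (\<lambda>x::real^'n. \<Prod>i\<in>UNIV. G i (vec_nth x i)) x
        = (\<Sum>i\<in>UNIV. (if i = k then G' k (vec_nth x k) * (\<Prod>j\<in>UNIV - {k}. G j (vec_nth x j)) else 0))"
        unfolding partial_deriv_eqI[OF diff[of G G', OF G'(2)]]
        by (intro sum.cong) (auto simp: axis_def)
      also have "\<dots> = G' k (vec_nth x k) * (\<Prod>j\<in>UNIV - {k}. G j (vec_nth x j))"
        by simp
      also have "\<dots> = (\<Prod>i\<in>UNIV. (G(k := G' k)) i (vec_nth x i))"
        by (simp add: prod.remove[of UNIV k])
      finally show ?thesis .
    qed
    with eq have "foldr partial_deriv (k # is) (\<lambda>x::real^'n. \<Prod>i\<in>UNIV. G0 i (vec_nth x i)) =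
        (\<lambda>x. \<Prod>i\<in>UNIV. (G(k := G' k)) i (vec_nth x i))" by auto
    moreover have "\<forall>i. flat_fun ((G(k := G' k)) i)" using G G'(1) by auto
    ultimately show ?case by blast
  qed
  note iter = this
  show ?thesis unfolding smooth_def
  proof
    fix "is" :: "'n list"
    obtain G1 where G: "\<forall>i. flat_fun (G1 i)"
      and eq: "foldr partial_deriv is (\<lambda>x::real^'n. \<Prod>i\<in>UNIV. G i (vec_nth x i)) = (\<lambda>x. \<Prod>i\<in>UNIV. G1 i (vec_nth x i))"
      using iter[OF assms] by blast
    have "\<forall>i. \<exists>f'. (\<forall>t. (G1 i has_real_derivative f' t) (at t))"
      using G flat_fun_deriv by blast
    from choice[OF this] obtain G' where "\<And>i t. (G1 i has_real_derivative G' i t) (at t)" by blast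
    from diff[of G1 G', OF this] show "foldr partial_deriv is (\<lambda>x::real^'n. \<Prod>i\<in>UNIV. G i (vec_nth x i)) differentiable_on UNIV"
      unfolding eq differentiable_on_def differentiable_def by auto
  qed
qed

text \<open>The arguments are k (x_i - a_i) - 1 and k (b_i - x_i) - 1, spelled out in the affine
  form that the constructor \<open>flat\<close> expects. The -1 keeps the support at distance 1/k
  from the faces of the box, and the factor k drives both arguments to infinity at interior
  points.\<close>

definition box_bump :: "real^'n \<Rightarrow> real^'n \<Rightarrow> nat \<Rightarrow> real^'n::finite \<Rightarrow> real" where
  "box_bump a b k x = (\<Prod>i\<in>UNIV. flat_exp 0 (real k * vec_nth x i + (- real k * vec_nth a i - 1)) *
     flat_exp 0 ((- real k) * vec_nth x i + (real k * vec_nth b i - 1)))"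

lemma box_bump_bounds: "0 \<le> box_bump a b k x" "box_bump a b k x \<le> 1"
  unfolding box_bump_def
  by (auto intro!: prod_nonneg prod_le_1 mult_le_one simp: flat_exp_def)

lemma box_bump_support: "box_bump a b k x \<noteq> 0 \<Longrightarrow> x \<in> cbox (\<chi> i. vec_nth a i + 1 / k) (\<chi> i. vec_nth b i - 1 / k)"
  and box_bump_nonzero_imp: "box_bump a b k x \<noteq> 0 \<Longrightarrow> 0 < k"
proof -
  assume "box_bump a b k x \<noteq> 0"
  then have *: "0 < real k * vec_nth x i + (- real k * vec_nth a i - 1)"
     "0 < (- real k) * vec_nth x i + (real k * vec_nth b i - 1)" for i
    by (auto simp: box_bump_def flat_exp_def split: if_splits)
  then show k: "0 < k" using *(1)[of undefined] by (cases "k = 0") auto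
  show "x \<in> cbox (\<chi> i. vec_nth a i + 1 / k) (\<chi> i. vec_nth b i - 1 / k)"
    using * k by (auto simp: mem_box_cart field_simps less_imp_le)
qed

lemma box_bump_test_function:
  assumes "box a b \<subseteq> \<Omega>"
  shows "box_bump a b k \<in> test_functions \<Omega>"
proof -
  have sm: "smooth (box_bump a b k)"
    unfolding box_bump_def[abs_def]
    by (rule smooth_flat_product[where G = "\<lambda>i t. flat_exp 0 (real k * t + (- real k * vec_nth a i - 1)) *
     flat_exp 0 ((- real k) * t + (real k * vec_nth b i - 1))"]) (intro allI flat_fun.mult flat_fun.flat)
  show ?thesis
  \<comment> \<open>Because 1 / 0 = 0, for k = 0 the shrunken box would be the whole closed box,
    which need not lie in the open one; the bump is then identically zero instead.\<close>
  proof (cases "k = 0")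
    case True
    then have "{x. box_bump a b k x \<noteq> 0} = {}" using box_bump_nonzero_imp[of a b k] by auto
    with sm show ?thesis by (simp add: test_functions_def)
  next
    case False
    let ?C = "cbox (\<chi> i. vec_nth a i + 1 / k) (\<chi> i. vec_nth b i - 1 / k)"
    have "closure {x. box_bump a b k x \<noteq> 0} \<subseteq> ?C"
      by (rule closure_minimal) (use box_bump_support in blast, rule closed_cbox)
    moreover from this have "compact (closure {x. box_bump a b k x \<noteq> 0})"
      by (metis bounded_cbox bounded_subset closed_closure compact_eq_bounded_closed)
    moreover have "?C \<subseteq> box a b"
    proof
      fix x assume x: "x \<in> ?C"
      define e where "e = 1 / real k"
      have "0 < e" using False by (simp add: e_def)
      have "vec_nth a i + e \<le> vec_nth x i \<and> vec_nth x i \<le> vec_nth b i - e" for i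
        using x by (auto simp: mem_box_cart e_def)
      note bounds = this
      have "vec_nth a i < vec_nth x i \<and> vec_nth x i < vec_nth b i" for i
        using bounds[of i] \<open>0 < e\<close> by linarith
      then show "x \<in> box a b" by (auto simp: mem_box_cart)
    qed
    ultimately show ?thesis using sm assms by (auto simp: test_functions_def)
  qed
qed

lemma flat_exp_tendsto_one: "(flat_exp 0 \<longlongrightarrow> 1) at_top"
proof -
  have "((\<lambda>t::real. exp (- inverse t)) \<longlongrightarrow> exp (- 0)) at_top"
    by (intro tendsto_intros tendsto_inverse_0_at_top filterlim_ident)
  then show ?thesis
    by (simp, elim Lim_transform_eventually)
      (auto simp: flat_exp_def eventually_at_top_dense intro!: exI[of _ 0])
qed

lemma box_bump_tendsto: "(\<lambda>k. box_bump a b k x) \<longlonglongrightarrow> indicat_real (box a b) x"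
proof (cases "x \<in> box a b")
  case True
  have lim: "(\<lambda>k. flat_exp 0 (real k * c - 1)) \<longlonglongrightarrow> 1" if "0 < c" for c
  proof -
    have "filterlim (\<lambda>k. c * real k) at_top sequentially"
      by (rule filterlim_tendsto_pos_mult_at_top[OF tendsto_const that filterlim_real_sequentially])
    then have "filterlim (\<lambda>k. (-1) + c * real k) at_top sequentially"
      by (rule filterlim_tendsto_add_at_top[OF tendsto_const])
    from filterlim_compose[OF flat_exp_tendsto_one this] show ?thesis by (simp add: mult.commute)
  qed
  have "(\<lambda>k. \<Prod>i\<in>UNIV. flat_exp 0 (real k * (vec_nth x i - vec_nth a i) - 1) *
      flat_exp 0 (real k * (vec_nth b i - vec_nth x i) - 1)) \<longlonglongrightarrow> (\<Prod>i\<in>(UNIV::'a set). 1 * 1)"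
    using True by (intro tendsto_prod tendsto_mult lim) (auto simp: mem_box_cart)
  then show ?thesis using True by (simp add: box_bump_def algebra_simps)
next
  case False
  then obtain i where i: "vec_nth x i \<le> vec_nth a i \<or> vec_nth b i \<le> vec_nth x i"
    by (auto simp: mem_box_cart not_less)
  have "box_bump a b k x = 0" for k
  proof -
    have "real k * vec_nth x i + (- real k * vec_nth a i - 1) \<le> 0 \<or>
        (- real k) * vec_nth x i + (real k * vec_nth b i - 1) \<le> 0"
      using i mult_left_mono[of "vec_nth x i" "vec_nth a i" "real k"]
        mult_left_mono[of "vec_nth b i" "vec_nth x i" "real k"] by auto
    then show ?thesis unfolding box_bump_def
      by (intro prod_zero) (auto simp: flat_exp_def intro!: exI[of _ i])
  qed
  with False show ?thesis by simp
qed

section \<open>The fundamental lemma of the calculus of variations\<close>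

lemma smooth_continuous_on:
  assumes "smooth \<psi>"
  shows "continuous_on S \<psi>"
proof -
  have "\<psi> differentiable_on UNIV" using assms unfolding smooth_def by (metis foldr.simps(1) id_apply)
  then show ?thesis by (meson continuous_on_subset differentiable_imp_continuous_on subset_UNIV)
qed

lemma continuous_imp_lebesgue_measurable:
  fixes \<psi> :: "'a::euclidean_space \<Rightarrow> real"
  assumes "continuous_on UNIV \<psi>"
  shows "\<psi> \<in> borel_measurable lebesgue"
proof (rule measurable_completion)
  show "\<psi> \<in> borel_measurable lborel"
    using borel_measurable_continuous_onI[OF assms] by simp
qed

lemma square_integrable_indicator:
  fixes A :: "'a::euclidean_space set"
  assumes "A \<in> lmeasurable"
  shows "square_integrable (indicat_real A)"
proof -
  have "(\<lambda>x. (indicat_real A x)\<^sup>2) = indicat_real A" by (auto simp: indicator_def)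
  with assms show ?thesis
    by (auto simp: square_integrable_def fmeasurable_def intro!: integrable_real_indicator)
qed

text \<open>Open boxes are an intersection-stable generator of the Borel sets, so an induction over
  the generated sigma-algebra makes the integral over every Borel set vanish, and a density with
  that property is zero almost everywhere.\<close>

lemma AE_zero_if_integral_boxes_zero:
  fixes g :: "real^'n::finite \<Rightarrow> real"
  assumes g: "integrable lebesgue g"
    and total: "integral\<^sup>L lebesgue g = 0"
    and boxes: "\<And>a b. (\<integral>x. indicat_real (box a b) x * g x \<partial>lebesgue) = 0"
  shows "AE x in lebesgue. g x = 0"
proof -
  \<comment> \<open>Boxes generate the Borel sets but not all Lebesgue sets, so the argument runs on
    a Borel representative.\<close>
  obtain g' where g'[measurable]: "g' \<in> borel_measurable lborel" and ae: "AE x in lborel. g x = g' x"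
    using completion_ex_borel_measurable_real[of g lborel] g by auto
  have ae': "AE x in lebesgue. g x = g' x" using ae by (rule AE_completion)
  have [measurable]: "g' \<in> borel_measurable lebesgue" "g \<in> borel_measurable lebesgue"
    using measurable_completion[OF g'] g by auto
  have "integrable lebesgue g'"
    using g integrable_cong_AE[of g lebesgue g'] ae' by simp
  then have int: "integrable lborel g'" by (simp add: integrable_completion)
  have si: "set_integrable lborel A g'" if "A \<in> sets borel" for A
    unfolding set_integrable_def using int that by (intro integrable_mult_indicator) auto
  have tr: "(\<integral>x. indicat_real A x * g' x \<partial>lborel) = (\<integral>x. indicat_real A x * g x \<partial>lebesgue)"
    if A: "A \<in> sets borel" for A
  proof -
    have [measurable]: "A \<in> sets lborel" "A \<in> sets lebesgue" using A by auto
    have "(\<integral>x. indicat_real A x * g' x \<partial>lborel) = (\<integral>x. indicat_real A x * g' x \<partial>lebesgue)"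
      by (rule integral_completion[symmetric]) measurable
    also have "\<dots> = (\<integral>x. indicat_real A x * g x \<partial>lebesgue)"
      by (rule integral_cong_AE) (use ae' in \<open>measurable, auto elim: eventually_mono\<close>)
    finally show ?thesis .
  qed
  have set_zero: "(LINT x:A|lborel. g' x) = 0" if A: "A \<in> sets lborel" for A
  proof -
    have "Int_stable (range (\<lambda>(a, b). box a b :: (real^'n) set))"
      by (auto simp: Int_stable_def box_Int_box)
    moreover have "(range (\<lambda>(a, b). box a b :: (real^'n) set)) \<subseteq> Pow UNIV" by auto
    moreover have "A \<in> sigma_sets UNIV (range (\<lambda>(a, b). box a b))"
      using A unfolding sets_lborel borel_eq_box by simp
    ultimately show ?thesis
    proof (induction rule: sigma_sets_induct_disjoint)
      case (basic A)
      then show ?case using tr boxes by (auto simp: set_lebesgue_integral_def)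
    next
      case empty
      then show ?case by (simp add: set_lebesgue_integral_def)
    next
      \<comment> \<open>The whole space is not a box; its integral has to come from
        \<open>total\<close>.\<close>
      case (compl A)
      then have A: "A \<in> sets borel" by (simp add: borel_eq_box)
      have "(LINT x:UNIV - A|lborel. g' x) + (LINT x:A|lborel. g' x) = (LINT x:(UNIV - A) \<union> A|lborel. g' x)"
        by (rule set_integral_Un[symmetric])
          (use A in \<open>auto intro!: si\<close>)
      also have "\<dots> = 0" using tr[of UNIV] total by (simp add: set_lebesgue_integral_def)
      finally show ?case using compl by simp
    next
      case (union F)
      then have [measurable]: "\<And>i. F i \<in> sets borel" by (simp add: borel_eq_box subset_eq)
      have "(LINT x:(\<Union>i. F i)|lborel. g' x) = (\<Sum>i. (LINT x:F i|lborel. g' x))"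
      proof (rule lebesgue_integral_countable_add)
        show "set_integrable lborel (\<Union>i. F i) g'" by (rule si) simp
      qed (use union(1) in \<open>auto simp: disjoint_family_on_def\<close>)
      then show ?case using union by simp
    qed
  qed
  have "AE x in lborel. g' x = 0"
  proof (rule sigma_finite_measure.density_zero)
    show "sigma_finite_measure (lborel :: (real^'n) measure)" by (rule sigma_finite_lborel)
    show "integrable lborel g'" by (rule int)
    show "set_lebesgue_integral lborel A g' = 0" if "A \<in> sets lborel" for A
      using that by (rule set_zero)
  qed
  with ae have "AE x in lborel. g x = 0" by eventually_elim simp
  then show ?thesis by (rule AE_completion)
qed

text \<open>Bumps converge to indicators of boxes, so testing against them gives zero integrals over
  all boxes inside the open set. On each such box the function then vanishes almost everywhere, and
  countably many boxes cover the open set.\<close>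

lemma fundamental_lemma:
  fixes f :: "real^'n::finite \<Rightarrow> real"
  assumes "open \<Omega>" and f: "square_integrable f"
    and test: "\<And>\<psi>. \<psi> \<in> test_functions \<Omega> \<Longrightarrow> (\<integral>x. f x * \<psi> x \<partial>lebesgue) = 0"
  shows "AE x in lebesgue. x \<in> \<Omega> \<longrightarrow> f x = 0"
proof -
  have [measurable]: "f \<in> borel_measurable lebesgue" using f by (simp add: square_integrable_def)
  \<comment> \<open>\<open>f\<close> is only square integrable; cutting it off by the square
    integrable indicator of a bounded box makes it integrable.\<close>
  have int: "integrable lebesgue (\<lambda>x. f x * indicat_real (box a b) x)" for a b
    by (intro square_integrable_mult f square_integrable_indicator) simp
  have box_zero: "(\<integral>x. f x * indicat_real (box a b) x \<partial>lebesgue) = 0" if "box a b \<subseteq> \<Omega>" for a b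
  proof -
    have test': "box_bump a b k \<in> test_functions \<Omega>" for k using that by (rule box_bump_test_function)
    then have [measurable]: "box_bump a b k \<in> borel_measurable lebesgue" for k
      by (intro continuous_imp_lebesgue_measurable smooth_continuous_on) (auto simp: test_functions_def)
    have "(\<lambda>k. \<integral>x. f x * box_bump a b k x \<partial>lebesgue) \<longlonglongrightarrow> (\<integral>x. f x * indicat_real (box a b) x \<partial>lebesgue)"
    proof (rule integral_dominated_convergence)
      show "integrable lebesgue (\<lambda>x. norm (f x * indicat_real (box a b) x))"
        using int by (rule integrable_norm)
      show "AE x in lebesgue. (\<lambda>k. f x * box_bump a b k x) \<longlonglongrightarrow> f x * indicat_real (box a b) x"
        by (intro AE_I2 tendsto_mult tendsto_const box_bump_tendsto)
      show "AE x in lebesgue. norm (f x * box_bump a b k x) \<le> norm (f x * indicat_real (box a b) x)" for k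
      proof (intro AE_I2)
        fix x
        have "\<bar>box_bump a b k x\<bar> \<le> indicat_real (box a b) x"
        proof (cases "x \<in> box a b")
          case True
          then show ?thesis using box_bump_bounds[of a b k x] by simp
        next
          case False
          \<comment> \<open>Taking the box itself as the domain shows that the bump vanishes off the
            box, so the indicator dominates it.\<close>
          have "box_bump a b k \<in> test_functions (box a b)" by (rule box_bump_test_function) simp
          then have "{x. box_bump a b k x \<noteq> 0} \<subseteq> box a b"
            using closure_subset[of "{x. box_bump a b k x \<noteq> 0}"] unfolding test_functions_def by blast
          with False show ?thesis by auto
        qed
        then show "norm (f x * box_bump a b k x) \<le> norm (f x * indicat_real (box a b) x)"
          by (simp add: abs_mult mult_left_mono)
      qed
      show "(\<lambda>x. f x * indicat_real (box a b) x) \<in> borel_measurable lebesgue"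
        using int by auto
      show "(\<lambda>x. f x * box_bump a b k x) \<in> borel_measurable lebesgue" for k
        by (intro borel_measurable_times) auto
    qed
    then show ?thesis using test[OF test'] by (simp add: LIMSEQ_const_iff)
  qed
  have on_box: "AE x in lebesgue. x \<in> box a b \<longrightarrow> f x = 0" if "box a b \<subseteq> \<Omega>" for a b
  proof -
    have "AE x in lebesgue. f x * indicat_real (box a b) x = 0"
    proof (rule AE_zero_if_integral_boxes_zero[OF int box_zero[OF that]])
      fix c d :: "real^'n"
      \<comment> \<open>The integral of the cut-off function over an arbitrary box is an integral of
        \<open>f\<close> over a smaller box, which again lies in the domain.\<close>
      obtain p q where pq: "box c d \<inter> box a b = box p q" using box_Int_box[of c d a b] by blast
      then have "box p q \<subseteq> \<Omega>" using that by blast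
      from box_zero[OF this] show "(\<integral>x. indicat_real (box c d) x * (f x * indicat_real (box a b) x) \<partial>lebesgue) = 0"
        unfolding pq[symmetric] by (simp add: indicator_inter_arith mult_ac)
    qed
    then show ?thesis by eventually_elim (auto simp: indicator_def)
  qed
  obtain D where D: "countable D" "D \<subseteq> Pow \<Omega>" "\<And>X. X \<in> D \<Longrightarrow> \<exists>a b. X = box a b" "\<Union>D = \<Omega>"
    using open_countable_Union_open_box[OF \<open>open \<Omega>\<close>] by blast
  have "AE x in lebesgue. x \<in> X \<longrightarrow> f x = 0" if X: "X \<in> D" for X
  proof -
    obtain a b where "X = box a b" using D(3)[OF X] by blast
    with on_box[of a b] D(2) X show ?thesis by blast
  qed
  then have "AE x in lebesgue. \<forall>X\<in>D. x \<in> X \<longrightarrow> f x = 0"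
    using AE_ball_countable[OF D(1), of "\<lambda>x X. x \<in> X \<longrightarrow> f x = 0" lebesgue] by blast
  then show ?thesis by eventually_elim (auto simp: D(4)[symmetric])
qed

section \<open>Integration by parts for test functions\<close>

lemma integrable_continuous_compact_support:
  fixes g :: "'a::euclidean_space \<Rightarrow> real"
  assumes "continuous_on UNIV g" and "\<And>x. g x \<noteq> 0 \<Longrightarrow> norm x \<le> R"
  shows "integrable lborel g" "integrable lebesgue g"
proof -
  have "integrable lborel (\<lambda>x. indicator (cball 0 R) x *\<^sub>R g x)"
    by (rule borel_integrable_compact) (auto intro: continuous_on_subset[OF assms(1)])
  moreover have "(\<lambda>x. indicator (cball 0 R) x *\<^sub>R g x) = g"
  proof
    show "indicator (cball 0 R) x *\<^sub>R g x = g x" for x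
      using assms(2)[of x] by (cases "g x = 0") auto
  qed
  ultimately show "integrable lborel g" by simp
  then show "integrable lebesgue g"
    using integrable_completion[of g lborel] by auto
qed

text \<open>The difference quotients of \<open>g\<close> in direction \<open>e\<close> integrate to zero by translation invariance.\<close>

lemma integral_directional_derivative_zero:
  fixes g g' :: "'a::euclidean_space \<Rightarrow> real"
  assumes deriv: "\<And>x. ((\<lambda>h. g (x + h *\<^sub>R e)) has_real_derivative g' x) (at 0)"
    and cont: "continuous_on UNIV g" "continuous_on UNIV g'"
    and supp: "\<And>x. g x \<noteq> 0 \<Longrightarrow> norm x \<le> R" "\<And>x. g' x \<noteq> 0 \<Longrightarrow> norm x \<le> R"
    and e: "norm e \<le> 1"
  shows "(\<integral>x. g' x \<partial>lebesgue) = 0"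
proof -
  have "compact (g' ` cball 0 R)"
    by (intro compact_continuous_image compact_cball continuous_on_subset[OF cont(2)]) auto
  then obtain B0 where B0: "\<And>x. x \<in> cball 0 R \<Longrightarrow> \<bar>g' x\<bar> \<le> B0"
    by (force dest!: compact_imp_bounded simp: bounded_iff)
  \<comment> \<open>If the ball is empty, \<open>B0\<close> may be negative; the maximum makes the
    bound valid where \<open>g'\<close> vanishes as well.\<close>
  define B where "B = max B0 0"
  have B: "\<bar>g' x\<bar> \<le> B" for x
    using B0[of x] supp(2)[of x] by (cases "g' x = 0") (auto simp: B_def)
  define h where "h k = 1 / real (Suc k)" for k
  have h: "0 < h k" "h k \<le> 1" for k by (auto simp: h_def)
  have h_lim: "h \<longlonglongrightarrow> 0" unfolding h_def by (rule LIMSEQ_Suc[OF lim_1_over_n])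
  define q where "q k x = (g (x + h k *\<^sub>R e) - g x) / h k" for k x
  note int_g = integrable_continuous_compact_support(1)[OF cont(1) supp(1)]
  have cont_shift: "continuous_on UNIV (\<lambda>x. g (x + c))" for c
    by (rule continuous_on_compose2[OF cont(1)]) (auto intro!: continuous_intros)
  have "integral\<^sup>L lborel (q k) = 0" for k
  proof -
    have "integral\<^sup>L lborel g = (\<integral>x. g x \<partial>distr lborel borel ((+) (h k *\<^sub>R e)))"
      by (simp add: lborel_distr_plus)
    also have "\<dots> = (\<integral>x. g (x + h k *\<^sub>R e) \<partial>lborel)"
      by (subst integral_distr) (auto simp: add.commute intro: borel_measurable_continuous_onI cont)
    finally have eq: "(\<integral>x. g (x + h k *\<^sub>R e) \<partial>lborel) = integral\<^sup>L lborel g" by simp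
    have "norm x \<le> R + norm (h k *\<^sub>R e)" if "g (x + h k *\<^sub>R e) \<noteq> 0" for x
      using supp(1)[OF that] norm_triangle_ineq4[of "x + h k *\<^sub>R e" "h k *\<^sub>R e"] by simp
    then have "integrable lborel (\<lambda>x. g (x + h k *\<^sub>R e))"
      by (rule integrable_continuous_compact_support(1)[OF cont_shift])
    with eq int_g show ?thesis by (simp add: q_def[abs_def])
  qed
  moreover have "(\<lambda>k. integral\<^sup>L lborel (q k)) \<longlonglongrightarrow> integral\<^sup>L lborel g'"
  proof (rule integral_dominated_convergence)
    show "g' \<in> borel_measurable lborel"
      using borel_measurable_continuous_onI[OF cont(2)] by simp
    show "q k \<in> borel_measurable lborel" for k
      unfolding q_def using borel_measurable_continuous_onI[OF cont(1)]
        borel_measurable_continuous_onI[OF cont_shift] by simp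
    \<comment> \<open>The mean value theorem bounds the quotients by \<open>B\<close>. A shift has
      length at most 1, since \<open>h k\<close> and the norm of \<open>e\<close> are at most 1, so
      all quotients live in the ball of radius R + 1.\<close>
    show "integrable lborel (\<lambda>x. B * indicat_real (cball 0 (R + 1)) x)"
      by (intro integrable_mult_right integrable_real_indicator)
        (auto intro: emeasure_lborel_cball_finite[unfolded infinity_ennreal_def])
    show "AE x in lborel. (\<lambda>k. q k x) \<longlonglongrightarrow> g' x"
    proof (intro AE_I2)
      fix x
      have "((\<lambda>s. (g (x + s *\<^sub>R e) - g x) / s) \<longlongrightarrow> g' x) (at 0)"
        using deriv[of x] by (simp add: DERIV_def)
      moreover have "filterlim h (at 0) sequentially"
        using h_lim h(1) by (auto simp: filterlim_at less_imp_neq[symmetric])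
      ultimately show "(\<lambda>k. q k x) \<longlonglongrightarrow> g' x"
        unfolding q_def by (rule filterlim_compose)
    qed
    show "AE x in lborel. norm (q k x) \<le> B * indicat_real (cball 0 (R + 1)) x" for k
    proof (intro AE_I2)
      fix x
      show "norm (q k x) \<le> B * indicat_real (cball 0 (R + 1)) x"
      proof (cases "x \<in> cball 0 (R + 1)")
        case True
        have D: "((\<lambda>s. g (x + s *\<^sub>R e)) has_real_derivative g' (x + t *\<^sub>R e)) (at t)" for t
          using DERIV_shift[of "\<lambda>s. g (x + s *\<^sub>R e)" "g' (x + t *\<^sub>R e)" 0 t] deriv[of "x + t *\<^sub>R e"]
          by (simp add: algebra_simps)
        obtain \<xi> where "g (x + h k *\<^sub>R e) - g (x + 0 *\<^sub>R e) = (h k - 0) * g' (x + \<xi> *\<^sub>R e)"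
          using MVT2[of 0 "h k" "\<lambda>s. g (x + s *\<^sub>R e)" "\<lambda>t. g' (x + t *\<^sub>R e)"] D h(1) by blast
        then have "q k x = g' (x + \<xi> *\<^sub>R e)"
          using h(1)[of k] by (simp add: q_def)
        with B True show ?thesis by simp
      next
        case False
        have "norm (h k *\<^sub>R e) \<le> 1" using h[of k] e by (simp add: mult_le_one)
        with False have "\<not> norm (x + h k *\<^sub>R e) \<le> R"
          using norm_triangle_ineq4[of "x + h k *\<^sub>R e" "h k *\<^sub>R e"] by auto
        moreover have "\<not> norm x \<le> R" using False by auto
        ultimately have "g (x + h k *\<^sub>R e) = 0" "g x = 0" using supp(1) by blast+
        with False show ?thesis by (simp add: q_def)
      qed
    qed
  qed
  ultimately have "integral\<^sup>L lborel g' = 0" by (simp add: LIMSEQ_const_iff)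
  moreover have "g' \<in> borel_measurable lborel"
    using borel_measurable_continuous_onI[OF cont(2)] by simp
  ultimately show ?thesis using integral_completion[of g' lborel] by simp
qed

lemma smooth_partial_deriv: "smooth \<psi> \<Longrightarrow> smooth (partial_deriv i \<psi>)"
  unfolding smooth_def
proof
  fix "is" assume "\<forall>is. foldr partial_deriv is \<psi> differentiable_on UNIV"
  \<comment> \<open>\<open>foldr\<close> applies the last entry of the list first.\<close>
  from this[rule_format, of "is @ [i]"]
  show "foldr partial_deriv is (partial_deriv i \<psi>) differentiable_on UNIV" by simp
qed

lemma smooth_differentiable: "smooth \<psi> \<Longrightarrow> \<psi> differentiable (at x)"
  unfolding smooth_def differentiable_on_def
  by (drule spec[of _ "[]"]) simp

lemma has_directional_derivative:
  assumes "smooth \<psi>"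
  shows "((\<lambda>h. \<psi> (x + h *\<^sub>R axis i 1)) has_real_derivative partial_deriv i \<psi> x) (at 0)"
proof -
  obtain D where D: "(\<psi> has_derivative D) (at x)"
    using smooth_differentiable[OF assms] unfolding differentiable_def by blast
  then have lin: "linear D" by (rule has_derivative_linear)
  have "((\<lambda>h. x + h *\<^sub>R axis i 1) has_derivative (\<lambda>h. h *\<^sub>R axis i 1)) (at 0)"
    by (auto intro!: derivative_eq_intros)
  from has_derivative_compose[OF this, of \<psi> D] D
  have "((\<lambda>h. \<psi> (x + h *\<^sub>R axis i 1)) has_derivative (\<lambda>h. D (h *\<^sub>R axis i 1))) (at 0)" by simp
  moreover have "(\<lambda>h. D (h *\<^sub>R axis i 1)) = (*) (partial_deriv i \<psi> x)"
    using partial_deriv_eqI[OF D, of i] linear_scale[OF lin] by (simp add: fun_eq_iff)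
  ultimately show ?thesis by (simp add: has_field_derivative_def)
qed

text \<open>The closure in the support matters for the derivative: the complement of the closure is
  open, so the function is zero on a neighbourhood of the point.\<close>

lemma test_function_support:
  assumes "\<psi> \<in> test_functions \<Omega>" "x \<notin> \<Omega>"
  shows "\<psi> x = 0" "partial_deriv i \<psi> x = 0"
proof -
  let ?K = "closure {x. \<psi> x \<noteq> 0}"
  have x: "x \<in> - ?K" using assms by (auto simp: test_functions_def)
  then show "\<psi> x = 0" using closure_subset[of "{x. \<psi> x \<noteq> 0}"] by blast
  have "(\<psi> has_derivative (\<lambda>_. 0)) (at x)"
  proof (rule has_derivative_transform_within_open)
    show "((\<lambda>_. 0) has_derivative (\<lambda>_. 0)) (at x)" by simp
    show "open (- ?K)" by (rule open_Compl[OF closed_closure])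
    show "0 = \<psi> y" if "y \<in> - ?K" for y
      using that closure_subset[of "{x. \<psi> x \<noteq> 0}"] by auto
  qed (rule x)
  from partial_deriv_eqI[OF this] show "partial_deriv i \<psi> x = 0" .
qed

lemma test_functionD:
  assumes "\<psi> \<in> test_functions \<Omega>"
  shows "smooth \<psi>" "continuous_on UNIV \<psi>" "continuous_on UNIV (partial_deriv i \<psi>)"
proof -
  show *: "smooth \<psi>" using assms by (simp add: test_functions_def)
  show "continuous_on UNIV \<psi>" by (rule smooth_continuous_on[OF *])
  show "continuous_on UNIV (partial_deriv i \<psi>)" by (rule smooth_continuous_on[OF smooth_partial_deriv[OF *]])
qed

lemma test_function_bounded_support:
  assumes "\<psi> \<in> test_functions \<Omega>"
  obtains R where "\<And>x. \<psi> x \<noteq> 0 \<Longrightarrow> norm x \<le> R" "\<And>x i. partial_deriv i \<psi> x \<noteq> 0 \<Longrightarrow> norm x \<le> R"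
proof -
  let ?K = "closure {x. \<psi> x \<noteq> 0}"
  \<comment> \<open>A test function is also a test function of its own support, which confines its
    derivatives to the same compact set.\<close>
  have K: "\<psi> \<in> test_functions ?K" and "bounded ?K"
    using assms by (auto simp: test_functions_def compact_imp_bounded)
  then obtain R where "\<And>x. x \<in> ?K \<Longrightarrow> norm x \<le> R" by (auto simp: bounded_iff)
  with test_function_support[OF K] show ?thesis by (intro that[of R]) blast+
qed

lemma square_integrable_test_function:
  assumes "\<psi> \<in> test_functions \<Omega>"
  shows "square_integrable \<psi>" "square_integrable (partial_deriv i \<psi>)"
proof -
  obtain R where R: "\<And>x. \<psi> x \<noteq> 0 \<Longrightarrow> norm x \<le> R" "\<And>x. partial_deriv i \<psi> x \<noteq> 0 \<Longrightarrow> norm x \<le> R"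
    using test_function_bounded_support[OF assms] by metis
  have "square_integrable g" if "continuous_on UNIV g" "\<And>x. g x \<noteq> 0 \<Longrightarrow> norm x \<le> R" for g
    unfolding square_integrable_def
    using that by (intro conjI continuous_imp_lebesgue_measurable integrable_continuous_compact_support(2)[where R = R]
        continuous_intros) auto
  note sq = this
  show "square_integrable \<psi>" by (rule sq) (use test_functionD[OF assms] R in auto)
  show "square_integrable (partial_deriv i \<psi>)" by (rule sq) (use test_functionD[OF assms] R in auto)
qed

text \<open>The sum of the two integrands is the partial derivative of the product, whose integral
  is zero; the support of the first factor already makes the product compactly supported.\<close>

lemma integral_by_parts:
  assumes \<psi>: "\<psi> \<in> test_functions \<Omega>" and \<theta>: "\<theta> \<in> test_functions V"
  shows "(\<integral>x. \<psi> x * partial_deriv i \<theta> x \<partial>lebesgue) = - (\<integral>x. partial_deriv i \<psi> x * \<theta> x \<partial>lebesgue)"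
proof -
  obtain R where R: "\<And>x. \<psi> x \<noteq> 0 \<Longrightarrow> norm x \<le> R"  "\<And>x. partial_deriv i \<psi> x \<noteq> 0 \<Longrightarrow> norm x \<le> R"
    using test_function_bounded_support[OF \<psi>] by metis
  have "(\<integral>x. \<psi> x * partial_deriv i \<theta> x + partial_deriv i \<psi> x * \<theta> x \<partial>lebesgue) = 0"
  proof (rule integral_directional_derivative_zero)
    show "((\<lambda>h. \<psi> (x + h *\<^sub>R axis i 1) * \<theta> (x + h *\<^sub>R axis i 1)) has_real_derivative
        \<psi> x * partial_deriv i \<theta> x + partial_deriv i \<psi> x * \<theta> x) (at 0)" for x
      using DERIV_mult[OF has_directional_derivative[OF test_functionD(1)[OF \<psi>], of x i]
          has_directional_derivative[OF test_functionD(1)[OF \<theta>], of x i]] by (simp add: algebra_simps)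
    show "norm (axis i (1::real)) \<le> 1" by (simp add: norm_axis_1)
    show "norm x \<le> R" if "\<psi> x * partial_deriv i \<theta> x + partial_deriv i \<psi> x * \<theta> x \<noteq> 0" for x
      using R[of x] that by (cases "\<psi> x = 0") auto
  qed (use R in \<open>auto intro!: continuous_intros test_functionD[OF \<psi>] test_functionD[OF \<theta>]\<close>)
  then show ?thesis
    using square_integrable_mult square_integrable_test_function[OF \<psi>] square_integrable_test_function[OF \<theta>]
    by (subst (asm) Bochner_Integration.integral_add) auto
qed

text \<open>From 0 = \<integral> psi^2 + 2 x_i psi d_i psi, Young's inequality and |x_i| \<le> R
  bound \<integral> psi^2 by half of itself plus 2 R^2 \<integral> (d_i psi)^2. Absorbing the half
  on the left produces the constant 4 R^2, and a single direction i suffices.\<close>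

lemma poincare_test_function:
  assumes \<psi>: "\<psi> \<in> test_functions \<Omega>" and R: "\<And>x. x \<in> \<Omega> \<Longrightarrow> norm x \<le> R"
  shows "(\<integral>x. (\<psi> x)\<^sup>2 \<partial>lebesgue) \<le> 4 * R\<^sup>2 * (\<integral>x. (partial_deriv i \<psi> x)\<^sup>2 \<partial>lebesgue)"
proof -
  let ?d = "partial_deriv i \<psi>"
  have supp: "\<psi> x \<noteq> 0 \<Longrightarrow> norm x \<le> R" "?d x \<noteq> 0 \<Longrightarrow> norm x \<le> R" for x
    using R test_function_support[OF \<psi>, of x] by blast+
  note cont = test_functionD(2,3)[OF \<psi>]
  \<comment> \<open>The integrand is the partial derivative of \<open>x\<^sub>i \<psi>\<^sup>2\<close>.\<close>
  have zero: "(\<integral>x. (\<psi> x)\<^sup>2 + 2 * (vec_nth x i * (\<psi> x * ?d x)) \<partial>lebesgue) = 0"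
  proof (rule integral_directional_derivative_zero)
    fix x :: "real^'a"
    have "((\<lambda>h. vec_nth x i + h) has_real_derivative 1) (at 0)" by (auto intro!: derivative_eq_intros)
    then have "((\<lambda>h. vec_nth (x + h *\<^sub>R axis i 1) i) has_real_derivative 1) (at 0)"
      by (simp add: axis_def)
    from DERIV_mult[OF this DERIV_power[OF has_directional_derivative[OF test_functionD(1)[OF \<psi>], of x i], of 2]]
    show "((\<lambda>h. vec_nth (x + h *\<^sub>R axis i 1) i * (\<psi> (x + h *\<^sub>R axis i 1))\<^sup>2) has_real_derivative
        (\<psi> x)\<^sup>2 + 2 * (vec_nth x i * (\<psi> x * ?d x))) (at 0)" by (simp add: algebra_simps)
    show "norm (axis i (1::real)) \<le> 1" by (simp add: norm_axis_1)
    show "norm x \<le> R" if "(\<psi> x)\<^sup>2 + 2 * (vec_nth x i * (\<psi> x * ?d x)) \<noteq> 0" for x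
      using supp(1)[of x] that by (cases "\<psi> x = 0") auto
  qed (use supp in \<open>auto intro!: continuous_intros cont\<close>)
  have int1: "integrable lebesgue (\<lambda>x. (\<psi> x)\<^sup>2)" and int2: "integrable lebesgue (\<lambda>x. (?d x)\<^sup>2)"
    using square_integrable_test_function[OF \<psi>] by (auto simp: square_integrable_def)
  have int3: "integrable lebesgue (\<lambda>x. 2 * (vec_nth x i * (\<psi> x * ?d x)))"
    by (rule integrable_continuous_compact_support(2)[where R = R])
      (use supp in \<open>auto intro!: continuous_intros cont\<close>)
  have pt: "- (2 * (vec_nth x i * (\<psi> x * ?d x))) \<le> (\<psi> x)\<^sup>2 / 2 + 2 * R\<^sup>2 * (?d x)\<^sup>2" for x
  proof (cases "\<psi> x = 0")
    case True
    then show ?thesis by simp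
  next
    case False
    then have "\<bar>vec_nth x i\<bar> \<le> R" using supp(1)[of x] component_le_norm_cart[of x i] by linarith
    then have "(vec_nth x i)\<^sup>2 \<le> R\<^sup>2" by (metis abs_ge_zero power2_abs power_mono)
    then have "(vec_nth x i)\<^sup>2 * (?d x)\<^sup>2 \<le> R\<^sup>2 * (?d x)\<^sup>2" by (rule mult_right_mono) simp
    \<comment> \<open>Half of this square is psi^2 / 2 + 2 x_i psi d_i psi + 2 x_i^2 (d_i psi)^2;
      this weighting leaves exactly half of psi^2 to absorb.\<close>
    moreover have "0 \<le> (\<psi> x + 2 * (vec_nth x i * ?d x))\<^sup>2" by simp
    ultimately show ?thesis by (simp add: power2_sum power_mult_distrib algebra_simps)
  qed
  have "(\<integral>x. (\<psi> x)\<^sup>2 \<partial>lebesgue) = (\<integral>x. - (2 * (vec_nth x i * (\<psi> x * ?d x))) \<partial>lebesgue)"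
    using zero int1 int3 by (simp only: Bochner_Integration.integral_add) simp
  also have "\<dots> \<le> (\<integral>x. (\<psi> x)\<^sup>2 / 2 + 2 * R\<^sup>2 * (?d x)\<^sup>2 \<partial>lebesgue)"
    by (rule integral_mono) (use int1 int2 int3 pt in auto)
  also have "\<dots> = (\<integral>x. (\<psi> x)\<^sup>2 \<partial>lebesgue) / 2 + 2 * R\<^sup>2 * (\<integral>x. (?d x)\<^sup>2 \<partial>lebesgue)"
    using int1 int2 by simp
  finally show ?thesis by simp
qed

section \<open>Weak gradients in L2\<close>

lemma square_integrable_rep_L2: "square_integrable (rep_L2 w)"
  using Quotient_rep_reflp[OF Quotient_L2, of w] by (simp add: L2_rel_def)

lemma rep_L2_abs_L2: "square_integrable f \<Longrightarrow> AE x in lebesgue. rep_L2 (abs_L2 f) x = f x"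
  using Quotient_rep_abs[OF Quotient_L2, of f] by (simp add: L2_rel_def)

lemma abs_rep_L2: "abs_L2 (rep_L2 w) = w"
  by (rule Quotient_abs_rep[OF Quotient_L2])

lemma abs_L2_eqI:
  assumes "square_integrable f" "square_integrable g" "AE x in lebesgue. f x = g x"
  shows "abs_L2 f = abs_L2 g"
  using assms Quotient_rel_abs[OF Quotient_L2] by (metis L2_rel_def)

lemma plus_abs_L2:
  "square_integrable f \<Longrightarrow> square_integrable g \<Longrightarrow> abs_L2 f + abs_L2 g = abs_L2 (\<lambda>x. f x + g x)"
  by (rule plus_L2.abs_eq) (auto simp: eq_onp_def L2_rel_def)

lemma scaleR_abs_L2: "square_integrable f \<Longrightarrow> c *\<^sub>R abs_L2 f = abs_L2 (\<lambda>x. c * f x)"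
  by (rule scaleR_L2.abs_eq) (auto simp: eq_onp_def L2_rel_def)

lemma zero_abs_L2: "0 = abs_L2 (\<lambda>_. 0)"
  using scaleR_abs_L2[OF square_integrable_zero, of 0] by simp

lemma inner_abs_L2:
  "square_integrable f \<Longrightarrow> square_integrable g \<Longrightarrow> inner (abs_L2 f) (abs_L2 g) = (\<integral>x. f x * g x \<partial>lebesgue)"
  by (rule inner_L2.abs_eq) (auto simp: eq_onp_def L2_rel_def)

lemma norm_abs_L2: "square_integrable f \<Longrightarrow> (norm (abs_L2 f))\<^sup>2 = (\<integral>x. (f x)\<^sup>2 \<partial>lebesgue)"
  unfolding power2_norm_eq_inner by (subst inner_abs_L2) (auto simp: power2_eq_square)

lemma inner_rep_L2: "square_integrable f \<Longrightarrow> inner w (abs_L2 f) = (\<integral>x. rep_L2 w x * f x \<partial>lebesgue)"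
  using inner_abs_L2[OF square_integrable_rep_L2, of f w] by (simp add: abs_rep_L2)

lemma rep_L2_plus: "AE x in lebesgue. rep_L2 (v + w) x = rep_L2 v x + rep_L2 w x"
  using rep_L2_abs_L2[OF square_integrable_add[OF square_integrable_rep_L2 square_integrable_rep_L2]]
    plus_abs_L2[OF square_integrable_rep_L2 square_integrable_rep_L2, of v w]
  by (metis abs_rep_L2)

lemma rep_L2_scaleR: "AE x in lebesgue. rep_L2 (c *\<^sub>R w) x = c * rep_L2 w x"
  using rep_L2_abs_L2[OF square_integrable_scale[OF square_integrable_rep_L2]]
    scaleR_abs_L2[OF square_integrable_rep_L2, of c w]
  by (metis abs_rep_L2)

lemma L2_onI: "square_integrable f \<Longrightarrow> (\<And>x. x \<notin> \<Omega> \<Longrightarrow> f x = 0) \<Longrightarrow> abs_L2 f \<in> L2_on \<Omega>"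
  unfolding L2_on_def using rep_L2_abs_L2[of f] by (auto elim!: eventually_mono)

lemma subspace_L2_on: "subspace (L2_on \<Omega>)"
proof (rule subspaceI)
  show "0 \<in> L2_on \<Omega>"
    unfolding zero_abs_L2 by (rule L2_onI) (auto simp: square_integrable_zero)
  fix v w :: "'a L2" and c :: real
  assume v: "v \<in> L2_on \<Omega>"
  show "c *\<^sub>R v \<in> L2_on \<Omega>"
    using v rep_L2_scaleR[of c v] unfolding L2_on_def mem_Collect_eq by eventually_elim simp
  assume w: "w \<in> L2_on \<Omega>"
  show "v + w \<in> L2_on \<Omega>"
    using v w rep_L2_plus[of v w] unfolding L2_on_def mem_Collect_eq by eventually_elim simp
qed

text \<open>Test functions and their derivatives vanish off the domain, so the integrals over it are
  L2 inner products on the whole space. In this form linearity of weak gradients is bilinearity of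
  \<open>inner\<close>, with no representatives involved.\<close>

lemma weak_gradient_iff:
  assumes "open \<Omega>"
  shows "weak_gradient \<Omega> w g \<longleftrightarrow> (\<forall>i. vec_nth g i \<in> L2_on \<Omega> \<and>
    (\<forall>\<psi>\<in>test_functions \<Omega>. inner w (abs_L2 (partial_deriv i \<psi>)) = - inner (vec_nth g i) (abs_L2 \<psi>)))"
proof -
  have on: "(\<integral>x. rep_L2 v x * f x \<partial>lebesgue_on \<Omega>) = inner v (abs_L2 f)"
    if f: "square_integrable f" and zero: "\<And>x. x \<notin> \<Omega> \<Longrightarrow> f x = 0" for v f
  proof -
    have "(\<integral>x. rep_L2 v x * f x \<partial>lebesgue_on \<Omega>) = (\<integral>x. indicat_real \<Omega> x *\<^sub>R (rep_L2 v x * f x) \<partial>lebesgue)"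
      using \<open>open \<Omega>\<close> by (intro integral_restrict_space) auto
    also have "(\<lambda>x. indicat_real \<Omega> x *\<^sub>R (rep_L2 v x * f x)) = (\<lambda>x. rep_L2 v x * f x)"
      using zero by (fastforce simp: indicator_def fun_eq_iff)
    finally show ?thesis using inner_rep_L2[OF f] by simp
  qed
  have "(\<integral>x. rep_L2 w x * partial_deriv i \<psi> x \<partial>lebesgue_on \<Omega>) = inner w (abs_L2 (partial_deriv i \<psi>))"
    "(\<integral>x. rep_L2 v x * \<psi> x \<partial>lebesgue_on \<Omega>) = inner v (abs_L2 \<psi>)"
    if "\<psi> \<in> test_functions \<Omega>" for i \<psi> v
    using square_integrable_test_function[OF that] test_function_support[OF that]
    by (simp_all add: on)
  then show ?thesis unfolding weak_gradient_def by simp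
qed

lemma weak_gradient_add:
  assumes "open \<Omega>" "weak_gradient \<Omega> v g" "weak_gradient \<Omega> w h"
  shows "weak_gradient \<Omega> (v + w) (g + h)"
  using assms(2,3) unfolding weak_gradient_iff[OF assms(1)]
  by (auto simp: inner_add_left intro: subspace_add[OF subspace_L2_on])

lemma weak_gradient_scaleR:
  assumes "open \<Omega>" "weak_gradient \<Omega> w g"
  shows "weak_gradient \<Omega> (c *\<^sub>R w) (c *\<^sub>R g)"
  using assms(2) unfolding weak_gradient_iff[OF assms(1)]
  by (auto intro: subspace_scale[OF subspace_L2_on])

text \<open>The fundamental lemma controls the function inside the domain only; membership in
  \<open>L2_on\<close> supplies the zero values outside.\<close>

lemma L2_on_eq_zero:
  fixes h :: "(real^'n::finite) L2"
  assumes "open \<Omega>" "h \<in> L2_on \<Omega>" "\<And>\<psi>. \<psi> \<in> test_functions \<Omega> \<Longrightarrow> inner h (abs_L2 \<psi>) = 0"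
  shows "h = 0"
proof -
  have "AE x in lebesgue. x \<in> \<Omega> \<longrightarrow> rep_L2 h x = 0"
  proof (rule fundamental_lemma[OF assms(1) square_integrable_rep_L2])
    show "(\<integral>x. rep_L2 h x * \<psi> x \<partial>lebesgue) = 0" if "\<psi> \<in> test_functions \<Omega>" for \<psi>
      using assms(3)[OF that] inner_rep_L2[OF square_integrable_test_function(1)[OF that], of h] by simp
  qed
  moreover have "AE x in lebesgue. x \<notin> \<Omega> \<longrightarrow> rep_L2 h x = 0"
    using assms(2) by (simp add: L2_on_def)
  ultimately have "AE x in lebesgue. rep_L2 h x = 0" by eventually_elim blast
  then have "abs_L2 (rep_L2 h) = abs_L2 (\<lambda>_. 0)"
    by (intro abs_L2_eqI square_integrable_rep_L2 square_integrable_zero)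
  then show ?thesis by (simp add: abs_rep_L2 zero_abs_L2)
qed

text \<open>The difference of two weak gradients is orthogonal to all test functions. This is what
  gives the description in \<open>grad\<close> a meaning, and the condition that components lie in
  \<open>L2_on\<close> fixes them off the domain.\<close>

lemma weak_gradient_unique:
  assumes "open \<Omega>" "weak_gradient \<Omega> w g" "weak_gradient \<Omega> w h"
  shows "g = h"
proof -
  have "vec_nth g i - vec_nth h i = 0" for i
    using assms(2,3) unfolding weak_gradient_iff[OF assms(1)]
    by (intro L2_on_eq_zero[OF assms(1)]) (auto simp: inner_diff_left intro: subspace_diff[OF subspace_L2_on])
  then show ?thesis by (simp add: Finite_Cartesian_Product.vec_eq_iff)
qed

lemma grad_eqI: "open \<Omega> \<Longrightarrow> weak_gradient \<Omega> w g \<Longrightarrow> grad \<Omega> w = g"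
  unfolding grad_def using weak_gradient_unique by blast

lemma weak_gradient_grad: "open \<Omega> \<Longrightarrow> w \<in> H1 \<Omega> \<Longrightarrow> weak_gradient \<Omega> w (grad \<Omega> w)"
  unfolding H1_def using grad_eqI by blast

lemma grad_add: "open \<Omega> \<Longrightarrow> v \<in> H1 \<Omega> \<Longrightarrow> w \<in> H1 \<Omega> \<Longrightarrow> grad \<Omega> (v + w) = grad \<Omega> v + grad \<Omega> w"
  by (blast intro: grad_eqI weak_gradient_add weak_gradient_grad)

lemma grad_scaleR: "open \<Omega> \<Longrightarrow> w \<in> H1 \<Omega> \<Longrightarrow> grad \<Omega> (c *\<^sub>R w) = c *\<^sub>R grad \<Omega> w"
  by (blast intro: grad_eqI weak_gradient_scaleR weak_gradient_grad)

lemma grad_diff: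
  assumes "open \<Omega>" "v \<in> H1 \<Omega>" "w \<in> H1 \<Omega>"
  shows "grad \<Omega> (v - w) = grad \<Omega> v - grad \<Omega> w"
  using grad_eqI[OF assms(1) weak_gradient_add[OF assms(1) weak_gradient_grad[OF assms(1,2)]
      weak_gradient_scaleR[OF assms(1) weak_gradient_grad[OF assms(1,3)], of "-1"]]]
  by simp

lemma subspace_H1:
  assumes "open \<Omega>"
  shows "subspace (H1 \<Omega>)"
proof (rule subspaceI)
  have "weak_gradient \<Omega> 0 0"
    unfolding weak_gradient_iff[OF assms] by (simp add: subspace_0[OF subspace_L2_on])
  then show "0 \<in> H1 \<Omega>" unfolding H1_def using subspace_0[OF subspace_L2_on] by blast
  show "v + w \<in> H1 \<Omega>" if "v \<in> H1 \<Omega>" "w \<in> H1 \<Omega>" for v w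
    using that weak_gradient_add[OF assms] subspace_add[OF subspace_L2_on] unfolding H1_def by blast
  show "c *\<^sub>R w \<in> H1 \<Omega>" if "w \<in> H1 \<Omega>" for c w
    using that weak_gradient_scaleR[OF assms] subspace_scale[OF subspace_L2_on] unfolding H1_def by blast
qed

text \<open>Integration by parts identifies classical and weak derivatives; it makes
  \<open>grad\<close> computable on the functions whose closure defines \<open>H10\<close>.\<close>

lemma test_function_weak_gradient:
  assumes "open \<Omega>" "\<psi> \<in> test_functions \<Omega>"
  shows "weak_gradient \<Omega> (abs_L2 \<psi>) (\<chi> i. abs_L2 (partial_deriv i \<psi>))"
  unfolding weak_gradient_iff[OF assms(1)]
  using square_integrable_test_function[OF assms(2)] test_function_support[OF assms(2)]
  by (auto simp: inner_abs_L2 square_integrable_test_function integral_by_parts[OF assms(2)] intro!: L2_onI)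

lemma test_function_H1:
  assumes "open \<Omega>" "\<psi> \<in> test_functions \<Omega>"
  shows "abs_L2 \<psi> \<in> H1 \<Omega>"
  unfolding H1_def
  using test_function_weak_gradient[OF assms] square_integrable_test_function[OF assms(2)]
    test_function_support[OF assms(2)] by (auto intro!: L2_onI)

section \<open>The space H10 and its Poincare inequality\<close>

lemma smooth_linear_combination:
  fixes \<psi> \<theta> :: "real^'n::finite \<Rightarrow> real"
  assumes "smooth \<psi>" "smooth \<theta>"
  shows "smooth (\<lambda>x. c * \<psi> x + \<theta> x)"
proof -
  have "foldr partial_deriv is (\<lambda>x. c * \<psi> x + \<theta> x) =
      (\<lambda>x. c * foldr partial_deriv is \<psi> x + foldr partial_deriv is \<theta> x)" for "is"
  proof (induction "is")
    case Nil
    then show ?case by simp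
  next
    case (Cons i "is")
    have "foldr partial_deriv is \<psi> differentiable at x" "foldr partial_deriv is \<theta> differentiable at x" for x
      using assms by (auto simp: smooth_def differentiable_on_def)
    then have "((\<lambda>x. c * foldr partial_deriv is \<psi> x + foldr partial_deriv is \<theta> x) has_derivative
        (\<lambda>y. c * frechet_derivative (foldr partial_deriv is \<psi>) (at x) y +
          frechet_derivative (foldr partial_deriv is \<theta>) (at x) y)) (at x)" for x
      by (intro derivative_intros) (simp_all add: frechet_derivative_works[symmetric])
    note step = partial_deriv_eqI[OF this]
    show ?case unfolding foldr_Cons o_apply Cons.IH
      by (rule ext) (simp only: step, simp only: partial_deriv_def)
  qed
  then show ?thesis using assms unfolding smooth_def
    by (auto intro!: differentiable_on_add differentiable_on_mult)
qed

lemma test_functions_linear_combination: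
  assumes "\<psi> \<in> test_functions \<Omega>" "\<theta> \<in> test_functions \<Omega>"
  shows "(\<lambda>x. c * \<psi> x + \<theta> x) \<in> test_functions \<Omega>"
proof -
  let ?K = "closure {x. \<psi> x \<noteq> 0} \<union> closure {x. \<theta> x \<noteq> 0}"
  have K: "compact ?K" "?K \<subseteq> \<Omega>" using assms by (auto simp: test_functions_def)
  have "{x. c * \<psi> x + \<theta> x \<noteq> 0} \<subseteq> {x. \<psi> x \<noteq> 0} \<union> {x. \<theta> x \<noteq> 0}" by auto
  from closure_mono[OF this] have sub: "closure {x. c * \<psi> x + \<theta> x \<noteq> 0} \<subseteq> ?K"
    by (simp only: closure_Un)
  then have "compact (closure {x. c * \<psi> x + \<theta> x \<noteq> 0})"
    using bounded_subset[OF compact_imp_bounded[OF K(1)] sub] by (simp only: compact_eq_bounded_closed) simp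
  with sub K(2) show ?thesis
    using assms smooth_linear_combination by (auto simp: test_functions_def)
qed

text \<open>The closure is taken in a metric space, hence is sequential, and convergence of pairs is
  componentwise. Linear combinations and norm inequalities can thus be passed to the limit together
  with their gradients.\<close>

lemma H10_iff_sequence:
  "w \<in> H10 \<Omega> \<longleftrightarrow> w \<in> H1 \<Omega> \<and> (\<exists>\<psi>. (\<forall>k. \<psi> k \<in> test_functions \<Omega>) \<and>
     (\<lambda>k. abs_L2 (\<psi> k)) \<longlonglongrightarrow> w \<and> (\<lambda>k. grad \<Omega> (abs_L2 (\<psi> k))) \<longlonglongrightarrow> grad \<Omega> w)"
proof -
  have "H1_embed \<Omega> w \<in> closure (H1_embed \<Omega> ` abs_L2 ` test_functions \<Omega>) \<longleftrightarrow>
      (\<exists>\<psi>. (\<forall>k. \<psi> k \<in> test_functions \<Omega>) \<and> (\<lambda>k. H1_embed \<Omega> (abs_L2 (\<psi> k))) \<longlonglongrightarrow> H1_embed \<Omega> w)"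
    (is "?L \<longleftrightarrow> ?R")
  proof
    assume ?L
    then obtain y where y: "\<forall>k. y k \<in> H1_embed \<Omega> ` abs_L2 ` test_functions \<Omega>" "y \<longlonglongrightarrow> H1_embed \<Omega> w"
      by (auto simp: closure_sequential)
    then have "\<forall>k. \<exists>\<psi>. \<psi> \<in> test_functions \<Omega> \<and> y k = H1_embed \<Omega> (abs_L2 \<psi>)" by blast
    from choice[OF this] obtain \<psi> where "\<forall>k. \<psi> k \<in> test_functions \<Omega> \<and> y k = H1_embed \<Omega> (abs_L2 (\<psi> k))"
      by blast
    then have "y = (\<lambda>k. H1_embed \<Omega> (abs_L2 (\<psi> k)))" "\<forall>k. \<psi> k \<in> test_functions \<Omega>" by auto
    then show ?R using y(2) by (intro exI[of _ \<psi>]) simp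
  next
    assume ?R
    then show ?L by (force simp: closure_sequential)
  qed
  moreover have "(\<lambda>k. H1_embed \<Omega> (v k)) \<longlonglongrightarrow> H1_embed \<Omega> w \<longleftrightarrow>
      v \<longlonglongrightarrow> w \<and> (\<lambda>k. grad \<Omega> (v k)) \<longlonglongrightarrow> grad \<Omega> w" for v
    unfolding H1_embed_def by (auto intro: tendsto_Pair dest: tendsto_fst tendsto_snd)
  ultimately show ?thesis by (simp add: H10_def)
qed

lemma subspace_H10:
  fixes \<Omega> :: "(real^'n::finite) set"
  assumes "open \<Omega>"
  shows "subspace (H10 \<Omega>)"
proof -
  have comb: "c *\<^sub>R v + w \<in> H10 \<Omega>" if "v \<in> H10 \<Omega>" "w \<in> H10 \<Omega>" for c v w
  proof -
    obtain \<psi> where v: "v \<in> H1 \<Omega>" and \<psi>: "\<And>k. \<psi> k \<in> test_functions \<Omega>"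
      "(\<lambda>k. abs_L2 (\<psi> k)) \<longlonglongrightarrow> v" "(\<lambda>k. grad \<Omega> (abs_L2 (\<psi> k))) \<longlonglongrightarrow> grad \<Omega> v"
      using \<open>v \<in> H10 \<Omega>\<close> unfolding H10_iff_sequence by blast
    obtain \<theta> where w: "w \<in> H1 \<Omega>" and \<theta>: "\<And>k. \<theta> k \<in> test_functions \<Omega>"
      "(\<lambda>k. abs_L2 (\<theta> k)) \<longlonglongrightarrow> w" "(\<lambda>k. grad \<Omega> (abs_L2 (\<theta> k))) \<longlonglongrightarrow> grad \<Omega> w"
      using \<open>w \<in> H10 \<Omega>\<close> unfolding H10_iff_sequence by blast
    note sub = subspace_H1[OF assms]
    have grad_comb: "grad \<Omega> (c *\<^sub>R p + q) = c *\<^sub>R grad \<Omega> p + grad \<Omega> q" if "p \<in> H1 \<Omega>" "q \<in> H1 \<Omega>" for p q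
      using that by (simp add: grad_add grad_scaleR assms subspace_scale[OF sub])
    have eq: "abs_L2 (\<lambda>x. c * \<psi> k x + \<theta> k x) = c *\<^sub>R abs_L2 (\<psi> k) + abs_L2 (\<theta> k)" for k
      using square_integrable_test_function(1)[OF \<psi>(1)] square_integrable_test_function(1)[OF \<theta>(1)]
      by (simp add: scaleR_abs_L2 plus_abs_L2 square_integrable_scale)
    have "(\<lambda>k. abs_L2 (\<lambda>x. c * \<psi> k x + \<theta> k x)) \<longlonglongrightarrow> c *\<^sub>R v + w"
      unfolding eq by (intro tendsto_intros \<psi> \<theta>)
    moreover have "(\<lambda>k. grad \<Omega> (abs_L2 (\<lambda>x. c * \<psi> k x + \<theta> k x))) \<longlonglongrightarrow> grad \<Omega> (c *\<^sub>R v + w)"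
      unfolding eq grad_comb[OF v w] grad_comb[OF test_function_H1[OF assms \<psi>(1)] test_function_H1[OF assms \<theta>(1)]]
      by (intro tendsto_intros \<psi> \<theta>)
    moreover have "c *\<^sub>R v + w \<in> H1 \<Omega>" using v w sub by (simp add: subspace_add subspace_scale)
    ultimately show ?thesis unfolding H10_iff_sequence
      using test_functions_linear_combination[OF \<psi>(1) \<theta>(1)]
      by (intro conjI exI[of _ "\<lambda>k x. c * \<psi> k x + \<theta> k x"]) auto
  qed
  have zero: "0 \<in> H10 \<Omega>"
  proof -
    \<comment> \<open>Zero is written as a product of zero factors over the nonempty index type, so
      that the product lemma applies.\<close>
    have "smooth (\<lambda>x::real^'n. 0)"
      using smooth_flat_product[of "\<lambda>(_::'n) _. 0"] flat_fun.const[of 0] by (simp add: power_0_left)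
    then have "(\<lambda>x. 0) \<in> test_functions \<Omega>" by (simp add: test_functions_def)
    then show ?thesis unfolding H10_iff_sequence
      by (intro conjI exI[of _ "\<lambda>_ _. 0"] subspace_0[OF subspace_H1[OF assms]]) (auto simp: zero_abs_L2)
  qed
  show ?thesis
  proof (rule subspaceI)
    show "0 \<in> H10 \<Omega>" by (rule zero)
    show "v + w \<in> H10 \<Omega>" if "v \<in> H10 \<Omega>" "w \<in> H10 \<Omega>" for v w
      using comb[OF that, of 1] by simp
    show "c *\<^sub>R v \<in> H10 \<Omega>" if "v \<in> H10 \<Omega>" for c v
      using comb[OF that zero, of c] by simp
  qed
qed

text \<open>Both sides are continuous along an approximating sequence of test functions, because the
  gradients converge as well.\<close>

lemma poincare_H10:
  fixes w :: "(real^'n::finite) L2"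
  assumes "open \<Omega>" "w \<in> H10 \<Omega>" and R: "\<And>x. x \<in> \<Omega> \<Longrightarrow> norm x \<le> R" "0 \<le> R"
  shows "norm w \<le> 2 * R * norm (grad \<Omega> w)"
proof -
  obtain \<psi> where \<psi>: "\<And>k. \<psi> k \<in> test_functions \<Omega>"
    "(\<lambda>k. abs_L2 (\<psi> k)) \<longlonglongrightarrow> w" "(\<lambda>k. grad \<Omega> (abs_L2 (\<psi> k))) \<longlonglongrightarrow> grad \<Omega> w"
    using assms(2) unfolding H10_iff_sequence by blast
  have "norm (abs_L2 (\<psi> k)) \<le> 2 * R * norm (grad \<Omega> (abs_L2 (\<psi> k)))" for k
  proof -
    \<comment> \<open>Any direction will do: \<open>undefined\<close> merely picks one, and the norm
      of that component is at most the norm of the gradient.\<close>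
    let ?d = "partial_deriv undefined (\<psi> k)"
    note sq = square_integrable_test_function[OF \<psi>(1)[of k]]
    have "(norm (abs_L2 (\<psi> k)))\<^sup>2 \<le> 4 * R\<^sup>2 * (norm (abs_L2 ?d))\<^sup>2"
      using poincare_test_function[OF \<psi>(1) R(1), of k undefined] sq
      by (simp add: norm_abs_L2)
    also have "\<dots> = (2 * R * norm (abs_L2 ?d))\<^sup>2" by (simp add: power_mult_distrib)
    finally have "norm (abs_L2 (\<psi> k)) \<le> 2 * R * norm (abs_L2 ?d)"
      by (rule power2_le_imp_le) (simp add: R(2))
    also have "\<dots> \<le> 2 * R * norm (grad \<Omega> (abs_L2 (\<psi> k)))"
      unfolding grad_eqI[OF assms(1) test_function_weak_gradient[OF assms(1) \<psi>(1)]]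
      using Finite_Cartesian_Product.norm_nth_le[of "\<chi> i. abs_L2 (partial_deriv i (\<psi> k))" undefined] R(2)
      by (intro mult_left_mono) auto
    finally show ?thesis .
  qed
  then show ?thesis
    by (intro LIMSEQ_le[OF tendsto_norm[OF \<psi>(2)] tendsto_mult[OF tendsto_const tendsto_norm[OF \<psi>(3)]]]) auto
qed

section \<open>The Ritz projection as a bounded operator\<close>

text \<open>One Gram-Schmidt step per inserted vector; finite dimension takes the place of
  completeness. The vector \<open>g\<close> must be arbitrary in the induction, which is applied
  both to \<open>g\<close> and to the new vector \<open>a\<close>.\<close>

lemma orthogonal_projection_exists:
  fixes g :: "'b::real_inner"
  assumes "finite S"
  shows "\<exists>p\<in>span S. \<forall>v\<in>span S. inner (g - p) v = 0"
  using assms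
proof (induction S arbitrary: g rule: finite_induct)
  case empty
  then show ?case by simp
next
  case (insert a S)
  obtain q where q: "q \<in> span S" "\<And>v. v \<in> span S \<Longrightarrow> inner (a - q) v = 0"
    using insert.IH[of a] by blast
  obtain p where p: "p \<in> span S" "\<And>v. v \<in> span S \<Longrightarrow> inner (g - p) v = 0"
    using insert.IH[of g] by blast
  define b where "b = a - q"
  \<comment> \<open>If \<open>a\<close> already lies in \<open>span S\<close>, then b = 0, and
    division by zero gives c = 0: the projection stays as it was.\<close>
  define c where "c = inner g b / inner b b"
  have b: "b \<in> span (insert a S)"
    unfolding b_def using q(1) by (meson insertI1 span_base span_diff span_mono subset_insertI subsetD)
  have orth: "inner b v = 0" if "v \<in> span S" for v using q(2)[OF that] by (simp add: b_def)
  have "inner (g - (p + c *\<^sub>R b)) b = 0"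
    using orth[OF p(1)] by (cases "b = 0") (simp_all add: c_def inner_simps inner_commute)
  moreover have "inner (g - (p + c *\<^sub>R b)) v = 0" if "v \<in> span S" for v
    using p(2)[OF that] orth[OF that] by (simp add: inner_simps)
  moreover have "\<exists>k w. w \<in> span S \<and> v = k *\<^sub>R b + w" if v: "v \<in> span (insert a S)" for v
  proof -
    obtain k where k: "v - k *\<^sub>R a \<in> span S" using v by (auto simp: span_breakdown_eq)
    then have "v - k *\<^sub>R a + k *\<^sub>R q \<in> span S" using q(1) by (intro span_add span_scale)
    then show ?thesis by (intro exI[of _ k] exI[of _ "v - k *\<^sub>R a + k *\<^sub>R q"]) (simp add: b_def algebra_simps)
  qed
  ultimately have "\<forall>v\<in>span (insert a S). inner (g - (p + c *\<^sub>R b)) v = 0"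
    by (auto simp: inner_add_right) (metis inner_add_right inner_scaleR_right mult_zero_right add.right_neutral)
  moreover have "p + c *\<^sub>R b \<in> span (insert a S)"
    using p(1) b by (meson span_add span_scale span_mono subset_insertI subsetD)
  ultimately show ?case by blast
qed

text \<open>The projection acts on arbitrary vector fields g: g is projected orthogonally onto the
  gradients of \<open>span F\<close> and then pulled back along the gradient, which is injective
  there. Boundedness of the composition with \<open>grad\<close> is a separate conclusion, since
  that of \<open>L\<close> alone would not give it without a bound for \<open>grad\<close> on
  \<open>span F\<close>.\<close>

lemma ritz_operator:
  fixes \<Omega> :: "(real^'n::finite) set"
  assumes \<Omega>: "open \<Omega>" "bounded \<Omega>" and F: "finite F" "span F \<subseteq> H10 \<Omega>"
  obtains L :: "(real^'n) L2 ^ 'n \<Rightarrow> (real^'n) L2" where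
    "bounded_linear L" "bounded_linear (\<lambda>g. grad \<Omega> (L g))" "\<And>g. L g \<in> span F"
    "\<And>g v. v \<in> span F \<Longrightarrow> inner (g - grad \<Omega> (L g)) (grad \<Omega> v) = 0"
    "\<And>w. w \<in> H1 \<Omega> \<Longrightarrow> ritz_projection \<Omega> (span F) w = L (grad \<Omega> w)"
proof -
  obtain R0 where "\<And>x. x \<in> \<Omega> \<Longrightarrow> norm x \<le> R0" using \<Omega>(2) by (auto simp: bounded_iff)
  then obtain R where R: "\<And>x. x \<in> \<Omega> \<Longrightarrow> norm x \<le> R" "0 \<le> R"
    using that by (metis max.coboundedI1 max.cobounded2)
  let ?V = "span F" and ?G = "grad \<Omega>"
  have H1: "v \<in> H1 \<Omega>" if "v \<in> ?V" for v using that F(2) by (auto simp: H10_def)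
  note G_add = grad_add[OF \<Omega>(1) H1 H1] and G_diff = grad_diff[OF \<Omega>(1) H1 H1]
    and G_scale = grad_scaleR[OF \<Omega>(1) H1]
  have poincare: "norm v \<le> 2 * R * norm (?G v)" if "v \<in> ?V" for v
    using poincare_H10[OF \<Omega>(1) _ R, of v] that F(2) by blast
  have G_zero: "?G 0 = 0" using G_scale[OF span_zero, of 0] by simp
  \<comment> \<open>\<open>grad\<close> is known to be linear only on \<open>H1\<close>, so the
    agreement of the span of the gradients of F with the gradients of the span is checked by hand,
    one inclusion at a time.\<close>
  have "subspace (?G ` ?V)"
  proof (rule subspaceI)
    show "0 \<in> ?G ` ?V" using G_zero span_zero by (metis image_eqI)
    show "x + y \<in> ?G ` ?V" if "x \<in> ?G ` ?V" "y \<in> ?G ` ?V" for x y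
    proof -
      from that obtain v w where "v \<in> ?V" "w \<in> ?V" "x = ?G v" "y = ?G w" by blast
      then show ?thesis using G_add[of v w] span_add[of v F w] by (intro image_eqI[of _ _ "v + w"]) auto
    qed
    show "c *\<^sub>R x \<in> ?G ` ?V" if x: "x \<in> ?G ` ?V" for c x
    proof -
      from x obtain v where "v \<in> ?V" "x = ?G v" by blast
      then show ?thesis using G_scale[of v c] span_scale[of v F c] by (intro image_eqI[of _ _ "c *\<^sub>R v"]) auto
    qed
  qed
  then have span_sub: "span (?G ` F) \<subseteq> ?G ` ?V"
    by (intro span_minimal image_mono) (auto intro: span_base)
  have "subspace {v \<in> ?V. ?G v \<in> span (?G ` F)}"
    by (rule subspaceI) (auto simp: G_zero G_add G_scale span_zero span_add span_scale)
  then have "?V \<subseteq> {v \<in> ?V. ?G v \<in> span (?G ` F)}"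
    by (intro span_minimal) (auto intro: span_base)
  then have G_span: "?G v \<in> span (?G ` F)" if "v \<in> ?V" for v using that by blast
  have ex: "\<exists>p. p \<in> ?V \<and> (\<forall>v\<in>?V. inner (g - ?G p) (?G v) = 0)" for g
  proof -
    obtain P where P: "P \<in> span (?G ` F)" "\<forall>v\<in>span (?G ` F). inner (g - P) v = 0"
      using orthogonal_projection_exists[of "?G ` F" g] F(1) by blast
    from P(1) span_sub obtain p where "p \<in> ?V" "P = ?G p" by blast
    with P(2) G_span show ?thesis by blast
  qed
  have unique: "p = q"
    if "p \<in> ?V" "\<forall>v\<in>?V. inner (g - ?G p) (?G v) = 0" "q \<in> ?V" "\<forall>v\<in>?V. inner (g - ?G q) (?G v) = 0" for p q g
  proof -
    have pq: "p - q \<in> ?V" using that by (simp add: span_diff)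
    \<comment> \<open>Testing both orthogonality relations with p - q shows that its gradient is
      zero; the Poincare inequality then gives p = q.\<close>
    have "inner (g - ?G q) (?G (p - q)) - inner (g - ?G p) (?G (p - q)) = 0"
      using that pq by simp
    then have "inner (?G (p - q)) (?G (p - q)) = 0"
      using G_diff[OF that(1,3)] by (simp add: inner_diff_left)
    then have "?G (p - q) = 0" by simp
    then show ?thesis using poincare[OF pq] by simp
  qed
  have "\<forall>g. \<exists>p. p \<in> ?V \<and> (\<forall>v\<in>?V. inner (g - ?G p) (?G v) = 0)" using ex by blast
  from choice[OF this] obtain L where
    L: "\<And>g. L g \<in> ?V" "\<And>g v. v \<in> ?V \<Longrightarrow> inner (g - ?G (L g)) (?G v) = 0" by blast
  \<comment> \<open>\<open>L\<close> was obtained by choice, so its linearity rests on uniqueness: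
    the sum of the chosen values satisfies the relation that characterises
    \<open>L (g + h)\<close>.\<close>
  have L_add: "L (g + h) = L g + L h" for g h
  proof (rule unique[of _ "g + h"])
    show "\<forall>v\<in>?V. inner (g + h - ?G (L g + L h)) (?G v) = 0"
    proof
      fix v assume "v \<in> ?V"
      then show "inner (g + h - ?G (L g + L h)) (?G v) = 0"
        using L(2)[of v g] L(2)[of v h] by (simp add: G_add[OF L(1) L(1)] inner_add_left inner_diff_left)
    qed
  qed (auto intro!: L span_add)
  have L_scale: "L (c *\<^sub>R g) = c *\<^sub>R L g" for c g
  proof (rule unique[of _ "c *\<^sub>R g"])
    show "\<forall>v\<in>?V. inner (c *\<^sub>R g - ?G (c *\<^sub>R L g)) (?G v) = 0"
    proof
      fix v assume "v \<in> ?V"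
      then have "c * inner (g - ?G (L g)) (?G v) = 0" using L(2) by simp
      then show "inner (c *\<^sub>R g - ?G (c *\<^sub>R L g)) (?G v) = 0"
        by (simp add: G_scale[OF L(1)] inner_diff_left algebra_simps)
    qed
  qed (auto intro!: L span_scale)
  \<comment> \<open>Test the orthogonality with L g itself and cancel one factor in Cauchy-Schwarz;
    the case split makes that factor nonzero.\<close>
  have GL: "norm (?G (L g)) \<le> norm g" for g
  proof (cases "?G (L g) = 0")
    case False
    have "(norm (?G (L g)))\<^sup>2 = inner g (?G (L g))"
      using L(2)[OF L(1), of g g] by (simp add: power2_norm_eq_inner inner_diff_left)
    also have "\<dots> \<le> norm g * norm (?G (L g))" by (rule norm_cauchy_schwarz)
    finally show ?thesis using False by (simp add: power2_eq_square)
  qed simp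
  show ?thesis
  proof (rule that[of L])
    have "norm (L g) \<le> norm g * (2 * R)" for g
    proof -
      have "norm (L g) \<le> 2 * R * norm (?G (L g))" by (rule poincare[OF L(1)])
      also have "\<dots> \<le> 2 * R * norm g" using GL R(2) by (intro mult_left_mono) auto
      finally show ?thesis by (simp add: mult.commute)
    qed
    then show "bounded_linear L" by (rule bounded_linear_intro[OF L_add L_scale])
    show "bounded_linear (\<lambda>g. ?G (L g))"
      by (rule bounded_linear_intro[where K = 1])
        (simp_all add: L_add L_scale G_add[OF L(1) L(1)] G_scale[OF L(1)] GL)
    show "ritz_projection \<Omega> ?V w = L (?G w)" if w: "w \<in> H1 \<Omega>" for w
      unfolding ritz_projection_def
    proof (rule the_equality)
      have G: "?G (w - p) = ?G w - ?G p" if "p \<in> ?V" for p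
        by (rule grad_diff[OF \<Omega>(1) w H1[OF that]])
      show "L (?G w) \<in> ?V \<and> (\<forall>v\<in>?V. inner (?G (w - L (?G w))) (?G v) = 0)"
        using L by (simp add: G)
      show "p = L (?G w)" if "p \<in> ?V \<and> (\<forall>v\<in>?V. inner (?G (w - p)) (?G v) = 0)" for p
        using that L by (intro unique[of p "?G w"]) (auto simp: G)
    qed
  qed (use L in auto)
qed

section \<open>The error estimate\<close>

text \<open>Differentiability of the pair (w, grad w) splits into its two projections, so time
  derivative and gradient commute.\<close>

lemma C1_intoD:
  assumes "C1_into \<Omega> Y T w"
  obtains w' where "\<And>t. t \<in> {0..T} \<Longrightarrow> w t \<in> Y" "\<And>t. t \<in> {0..T} \<Longrightarrow> w' t \<in> Y"
    "\<And>t. t \<in> {0..T} \<Longrightarrow> (w has_vector_derivative w' t) (at t within {0..T})"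
    "\<And>t. t \<in> {0..T} \<Longrightarrow> ((\<lambda>s. grad \<Omega> (w s)) has_vector_derivative grad \<Omega> (w' t)) (at t within {0..T})"
proof -
  obtain w' where w': "\<And>t. t \<in> {0..T} \<Longrightarrow> w t \<in> Y" "\<And>t. t \<in> {0..T} \<Longrightarrow> w' t \<in> Y"
    "\<And>t. t \<in> {0..T} \<Longrightarrow> ((\<lambda>s. H1_embed \<Omega> (w s)) has_vector_derivative H1_embed \<Omega> (w' t)) (at t within {0..T})"
    using assms unfolding C1_into_def by blast
  show ?thesis
    using bounded_linear.has_vector_derivative[OF bounded_linear_fst w'(3)]
      bounded_linear.has_vector_derivative[OF bounded_linear_snd w'(3)]
    by (intro that[of w'] w'(1,2)) (auto simp: H1_embed_def)
qed

text \<open>Derivatives within a nondegenerate interval are unique, endpoints included, so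
  \<open>time_deriv\<close> may be replaced by any derivative at hand; 0 < T is what makes the
  interval nondegenerate.\<close>

lemma galerkin_heat_deriv:
  assumes "galerkin_heat \<Omega> V T \<nu> f w" "0 < T" "t \<in> {0..T}" "v \<in> V"
    and "(w has_vector_derivative w') (at t within {0..T})"
  shows "inner w' v + \<nu> * inner (grad \<Omega> (w t)) (grad \<Omega> v) = inner (f t) v"
proof -
  have "time_deriv T w t = w'"
    using vector_derivative_within_cbox[of 0 T t w w'] assms by simp
  then show ?thesis using assms by (auto simp: galerkin_heat_def)
qed

text \<open>The existential form asserts that both derivatives exist, one-sided at the endpoints,
  rather than comparing default values. The witness for \<eta>_t applies the Ritz operator to grad
  (u' t), and D is twice the inner product of the gradients of \<phi>_r and of its time
  derivative.\<close>

lemma ritz_energy_inequality: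
  fixes \<Omega> :: "(real^'n::finite) set"
  assumes \<Omega>: "open \<Omega>" "bounded \<Omega>" and "0 < T" "0 < \<nu>"
    and F: "finite F" "span F \<subseteq> H10 \<Omega>"
    and u: "C1_into \<Omega> (H10 \<Omega>) T u" "galerkin_heat \<Omega> (H10 \<Omega>) T \<nu> f u"
    and ur: "C1_into \<Omega> (span F) T ur" "galerkin_heat \<Omega> (span F) T \<nu> f ur"
    and t: "t \<in> {0..T}"
  shows "\<exists>\<eta>\<^sub>t D.
    ((\<lambda>s. u s - ritz_projection \<Omega> (span F) (u s)) has_vector_derivative \<eta>\<^sub>t) (at t within {0..T}) \<and>
    ((\<lambda>s. (norm (grad \<Omega> (ur s - ritz_projection \<Omega> (span F) (u s))))\<^sup>2) has_real_derivative D) (at t within {0..T}) \<and>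
    D \<le> 1 / \<nu> * (norm \<eta>\<^sub>t)\<^sup>2"
proof -
  let ?V = "span F" and ?G = "grad \<Omega>" and ?R = "ritz_projection \<Omega> (span F)"
  obtain L where L: "bounded_linear L" "bounded_linear (\<lambda>g. ?G (L g))" "\<And>g. L g \<in> ?V"
    "\<And>g v. v \<in> ?V \<Longrightarrow> inner (g - ?G (L g)) (?G v) = 0" "\<And>w. w \<in> H1 \<Omega> \<Longrightarrow> ?R w = L (?G w)"
    using ritz_operator[OF \<Omega> F] by metis
  obtain u' where u': "\<And>t. t \<in> {0..T} \<Longrightarrow> u t \<in> H10 \<Omega>" "\<And>t. t \<in> {0..T} \<Longrightarrow> u' t \<in> H10 \<Omega>"
    "\<And>t. t \<in> {0..T} \<Longrightarrow> (u has_vector_derivative u' t) (at t within {0..T})"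
    "\<And>t. t \<in> {0..T} \<Longrightarrow> ((\<lambda>s. ?G (u s)) has_vector_derivative ?G (u' t)) (at t within {0..T})"
    using C1_intoD[OF u(1)] by metis
  obtain ur' where ur': "\<And>t. t \<in> {0..T} \<Longrightarrow> ur t \<in> ?V" "\<And>t. t \<in> {0..T} \<Longrightarrow> ur' t \<in> ?V"
    "\<And>t. t \<in> {0..T} \<Longrightarrow> (ur has_vector_derivative ur' t) (at t within {0..T})"
    "\<And>t. t \<in> {0..T} \<Longrightarrow> ((\<lambda>s. ?G (ur s)) has_vector_derivative ?G (ur' t)) (at t within {0..T})"
    using C1_intoD[OF ur(1)] by metis
  have H1: "w \<in> H1 \<Omega>" if "w \<in> H10 \<Omega>" for w using that by (simp add: H10_def)
  have R: "?R (u s) = L (?G (u s))" if "s \<in> {0..T}" for s using L(5)[OF H1[OF u'(1)[OF that]]] .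
  define \<eta>\<^sub>t where "\<eta>\<^sub>t = u' t - L (?G (u' t))"
  define \<phi>\<^sub>t where "\<phi>\<^sub>t = ur' t - L (?G (u' t))"
  \<comment> \<open>This is the gradient of \<phi>_r, split into two curves that are each known to
    be differentiable.\<close>
  define g where "g s = ?G (ur s) - ?G (L (?G (u s)))" for s
  have \<phi>\<^sub>t: "\<phi>\<^sub>t \<in> ?V" unfolding \<phi>\<^sub>t_def using ur'(2)[OF t] L(3) by (rule span_diff)
  have G_\<phi>\<^sub>t: "?G \<phi>\<^sub>t = ?G (ur' t) - ?G (L (?G (u' t)))"
    unfolding \<phi>\<^sub>t_def using ur'(2)[OF t] L(3) F(2) H1 by (intro grad_diff \<Omega>) blast+
  \<comment> \<open>\<open>ritz_projection\<close> is known to equal L o grad only where u s lies in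
    \<open>H10\<close>, that is for s in [0,T]; a derivative within that interval sees no other
    values.\<close>
  have deriv_\<eta>: "((\<lambda>s. u s - ?R (u s)) has_vector_derivative \<eta>\<^sub>t) (at t within {0..T})"
  proof (rule has_vector_derivative_transform[OF t])
    show "((\<lambda>s. u s - L (?G (u s))) has_vector_derivative \<eta>\<^sub>t) (at t within {0..T})"
      unfolding \<eta>\<^sub>t_def
      by (intro has_vector_derivative_diff u'(3)[OF t] bounded_linear.has_vector_derivative[OF L(1) u'(4)[OF t]])
  qed (simp add: R)
  have "(g has_vector_derivative ?G \<phi>\<^sub>t) (at t within {0..T})"
    unfolding g_def[abs_def] G_\<phi>\<^sub>t
    by (intro has_vector_derivative_diff ur'(4)[OF t] bounded_linear.has_vector_derivative[OF L(2) u'(4)[OF t]])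
  then have deriv_g: "((\<lambda>s. inner (g s) (g s)) has_real_derivative 2 * inner (g t) (?G \<phi>\<^sub>t)) (at t within {0..T})"
    unfolding has_vector_derivative_def has_field_derivative_def
    by (intro has_derivative_eq_rhs[OF has_derivative_inner])
      (auto simp: fun_eq_iff inner_commute algebra_simps)
  have deriv_\<phi>: "((\<lambda>s. (norm (?G (ur s - ?R (u s))))\<^sup>2) has_real_derivative 2 * inner (g t) (?G \<phi>\<^sub>t)) (at t within {0..T})"
  proof (rule has_field_derivative_transform_within)
    show "((\<lambda>s. inner (g s) (g s)) has_real_derivative 2 * inner (g t) (?G \<phi>\<^sub>t)) (at t within {0..T})"
      by (rule deriv_g)
    show "0 < (1::real)" by simp
    show "t \<in> {0..T}" by (rule t)
    fix s assume s: "s \<in> {0..T}"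
    have "?G (ur s - ?R (u s)) = g s"
      unfolding R[OF s] g_def using ur'(1)[OF s] L(3) F(2) H1 by (intro grad_diff \<Omega>) blast+
    then show "inner (g s) (g s) = (norm (?G (ur s - ?R (u s))))\<^sup>2"
      by (simp add: power2_norm_eq_inner)
  qed
  \<comment> \<open>The time derivative of \<phi>_r lies in the reduced space and hence in
    \<open>H10\<close>, so it may be tested in both equations; the source term f drops out.\<close>
  have "inner (ur' t) \<phi>\<^sub>t + \<nu> * inner (?G (ur t)) (?G \<phi>\<^sub>t) = inner (u' t) \<phi>\<^sub>t + \<nu> * inner (?G (u t)) (?G \<phi>\<^sub>t)"
    using galerkin_heat_deriv[OF ur(2) \<open>0 < T\<close> t \<phi>\<^sub>t ur'(3)[OF t]]
      galerkin_heat_deriv[OF u(2) \<open>0 < T\<close> t _ u'(3)[OF t]] \<phi>\<^sub>t F(2) by force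
  \<comment> \<open>Orthogonality of the Ritz projection removes the gradient of \<eta>, so only its
    time derivative is left on the right-hand side.\<close>
  moreover have "inner (?G (u t)) (?G \<phi>\<^sub>t) = inner (?G (L (?G (u t)))) (?G \<phi>\<^sub>t)"
    using L(4)[OF \<phi>\<^sub>t, of "?G (u t)"] by (simp add: inner_diff_left)
  \<comment> \<open>Only the left factor of \<open>inner \<phi>\<^sub>t \<phi>\<^sub>t\<close> is
    expanded; the test function stays folded so that all terms match.\<close>
  ultimately have energy: "\<nu> * inner (g t) (?G \<phi>\<^sub>t) = inner \<eta>\<^sub>t \<phi>\<^sub>t - inner \<phi>\<^sub>t \<phi>\<^sub>t"
    unfolding g_def \<eta>\<^sub>t_def by (subst (3) \<phi>\<^sub>t_def) (simp add: inner_diff_left algebra_simps)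
  have "0 \<le> inner (\<eta>\<^sub>t - 2 *\<^sub>R \<phi>\<^sub>t) (\<eta>\<^sub>t - 2 *\<^sub>R \<phi>\<^sub>t)" by simp
  then have "4 * (inner \<eta>\<^sub>t \<phi>\<^sub>t - inner \<phi>\<^sub>t \<phi>\<^sub>t) \<le> inner \<eta>\<^sub>t \<eta>\<^sub>t"
    by (simp add: inner_diff_left inner_diff_right inner_commute)
  \<comment> \<open>The square above already bounds \<nu> D by half of the squared norm of \<eta>_t;
    nonnegativity relaxes this to the stated constant 1/\<nu>.\<close>
  moreover have "0 \<le> inner \<eta>\<^sub>t \<eta>\<^sub>t" by simp
  moreover have "\<nu> * (2 * inner (g t) (?G \<phi>\<^sub>t)) = 2 * (inner \<eta>\<^sub>t \<phi>\<^sub>t - inner \<phi>\<^sub>t \<phi>\<^sub>t)"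
    using energy by simp
  ultimately have "\<nu> * (2 * inner (g t) (?G \<phi>\<^sub>t)) \<le> (norm \<eta>\<^sub>t)\<^sup>2"
    unfolding power2_norm_eq_inner by linarith
  then have "2 * inner (g t) (?G \<phi>\<^sub>t) \<le> 1 / \<nu> * (norm \<eta>\<^sub>t)\<^sup>2"
    using \<open>0 < \<nu>\<close> by (simp add: field_simps)
  with deriv_\<eta> deriv_\<phi> show ?thesis by blast
qed

text \<open>POD functions are linear combinations of snapshots, and snapshots are values of w at the
  nodes or scaled differences of such values.\<close>

lemma pod_space_subset:
  assumes "subspace Y" "\<And>n. n \<le> N \<Longrightarrow> w (\<tau> n) \<in> Y"
  shows "span (pod_basis (2 * N + 1) (snapshot N \<Delta>t \<tau> w) lam ev ` A) \<subseteq> Y"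
proof -
  \<comment> \<open>With j at most 2 N, the node indices j - N and j - N - 1 of the difference
    quotients do not exceed N.\<close>
  have "snapshot N \<Delta>t \<tau> w j \<in> Y" if "j < 2 * N + 1" for j
    using that unfolding snapshot_def
    by (auto intro!: assms(2) subspace_scale[OF assms(1)] subspace_diff[OF assms(1)])
  then have "pod_basis (2 * N + 1) (snapshot N \<Delta>t \<tau> w) lam ev k \<in> Y" for k
    unfolding pod_basis_def
    by (intro subspace_scale[OF assms(1)] subspace_sum[OF assms(1)]) auto
  then show ?thesis by (intro span_minimal assms(1)) auto
qed

theorem mainTheorem2:
  fixes \<Omega> :: "(real^'n::finite) set"
    and T \<nu> \<Delta>t :: real
    and f u u\<^sub>r :: "real \<Rightarrow> (real^'n) L2"
    and N d r :: nat
    and \<tau> lam :: "nat \<Rightarrow> real"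
    and ev :: "nat \<Rightarrow> real Matrix.vec"
  defines "M \<equiv> 2 * N + 1"
    and "s \<equiv> snapshot N \<Delta>t \<tau> u"
  defines "\<phi> \<equiv> pod_basis M s lam ev"
  defines "X\<^sub>r \<equiv> span (\<phi> ` {1..r})"
  defines "\<eta> \<equiv> \<lambda>t. u t - ritz_projection \<Omega> X\<^sub>r (u t)"
    and "\<phi>\<^sub>r \<equiv> \<lambda>t. u\<^sub>r t - ritz_projection \<Omega> X\<^sub>r (u t)"
  assumes "open \<Omega>" "connected \<Omega>" "\<Omega> \<noteq> {}" "bounded \<Omega>"
    and "0 < T" "0 < \<nu>"
    and "continuous_on {0..T} f" "\<forall>t\<in>{0..T}. f t \<in> L2_on \<Omega>"
    and "C1_into \<Omega> (H10 \<Omega>) T u"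
    and "galerkin_heat \<Omega> (H10 \<Omega>) T \<nu> f u"
    and "0 < \<Delta>t" "\<forall>n\<le>N. \<tau> n \<in> {0..T}" "\<forall>n<N. \<tau> (Suc n) = \<tau> n + \<Delta>t"
    and "d = dim (span (s ` {..<M}))"
    and "antimono_on {1..d} lam" "\<forall>k\<in>{1..d}. 0 < lam k"
    and "\<forall>k\<in>{1..d}. eigenvector (correlation_matrix M s) (ev k) (lam k)"
    and "\<forall>k\<in>{1..d}. \<forall>l\<in>{1..d}. scalar_prod (ev k) (ev l) = (if k = l then 1 else 0)"
    and "1 \<le> r" "r \<le> d"
    and "C1_into \<Omega> X\<^sub>r T u\<^sub>r"
    and "galerkin_heat \<Omega> X\<^sub>r T \<nu> f u\<^sub>r"
  shows "\<forall>t\<in>{0..T}. \<exists>\<eta>\<^sub>t D.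
           (\<eta> has_vector_derivative \<eta>\<^sub>t) (at t within {0..T}) \<and>
           ((\<lambda>t'. (norm (grad \<Omega> (\<phi>\<^sub>r t')))\<^sup>2) has_real_derivative D) (at t within {0..T}) \<and>
           D \<le> 1 / \<nu> * (norm \<eta>\<^sub>t)\<^sup>2"
proof
  fix t assume t: "t \<in> {0..T}"
  have "u (\<tau> n) \<in> H10 \<Omega>" if "n \<le> N" for n
    \<comment> \<open>The first six entries of \<open>assms\<close> are the definitions; 15 is the
      regularity of \<open>u\<close>, and 18 places the snapshot times in [0,T].\<close>
    using assms(15,18) that unfolding C1_into_def by blast
  then have "X\<^sub>r \<subseteq> H10 \<Omega>"
    unfolding X\<^sub>r_def \<phi>_def s_def M_def
    by (intro pod_space_subset subspace_H10 \<open>open \<Omega>\<close>)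
  then show "\<exists>\<eta>\<^sub>t D.
      (\<eta> has_vector_derivative \<eta>\<^sub>t) (at t within {0..T}) \<and>
      ((\<lambda>t'. (norm (grad \<Omega> (\<phi>\<^sub>r t')))\<^sup>2) has_real_derivative D) (at t within {0..T}) \<and>
      D \<le> 1 / \<nu> * (norm \<eta>\<^sub>t)\<^sup>2"
    unfolding \<eta>_def \<phi>\<^sub>r_def X\<^sub>r_def
    by (intro ritz_energy_inequality[of \<Omega> T \<nu> _ u f] t) (use assms X\<^sub>r_def in auto)
qed

end
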